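(* Let $J\subseteq S$, let $M_1,M_2$ be $k\Omega_J$-modules and $\phi:M_1\to M_2$ a $k\Omega_J$-linear map. (a) The map $\mathrm{HY}_J^S(\phi):\mathrm{HY}_J^S(M_1)\to\mathrm{HY}_J^S(M_2)$, $z|m_1\mapsto z|\phi(m_1)$, is $\Omega$-linear. In particular $\mathrm{HY}_J^S$ is a functor from $k\Omega_J$-modules to $k\Omega$-modules. (b) $\mathrm{HY}_J^S(\phi)$ commutes with the canonicalisations, that is \[c_{M_2}\circ(\mathrm{id}_{k[\Gamma]}\otimes\mathrm{HY}_J^S(\phi))=\mathrm{Ind}_{H_J}^H(\phi)\circ c_{M_1}\] as maps $\mathrm{Res}_H^\Omega\mathrm{HY}_J^S(M_1)\to\mathrm{Ind}_{H_J}^H\mathrm{Res}_{H_J}^{\Omega_J}M_2$. In other words, $c$ is a natural isomorphism $\mathrm{Res}_H^\Omega\circ\mathrm{HY}_J^S\to\mathrm{Ind}_{H_J}^H\circ\mathrm{Res}_{H_J}^{\Omega_J}$.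
   Context: Setting. $k$ is a commutative ring; $(W,S)$ is a (not necessarily finite) Coxeter group with length function $l$ and Bruhat–Chevalley order $\le$; $m_{st}$ is the order of $st$. $\Gamma=\mathbb{Z}$, and $L:W\to\Gamma$ is a weight function ($L(xy)=L(x)+L(y)$ whenever $l(xy)=l(x)+l(y)$) with $L(s)>0$ for all $s\in S$. $\mathbb{Z}[\Gamma]$, $k[\Gamma]$ are the Laurent polynomial rings in $v$ (the group element $\gamma$ is written $v^\gamma$), $v_s:=v^{L(s)}$. For a ring or module $A$, $\mathbb{Z}[\Gamma]A:=\mathbb{Z}[\Gamma]\otimes_{\mathbb{Z}}A$ (similarly $k[\Gamma]A=k[\Gamma]\otimes_kA$ for $k$-modules), $\mathbb{Z}[\Gamma_{>0}]A$ (resp. $\mathbb{Z}[\Gamma_{\ge0}]A$) is the subgroup of elements involving only exponents $>0$ (resp. $\ge0$), and $\overline{\phantom{m}}$ is the map $v^\gamma\otimes a\mapsto v^{-\gamma}\otimes a$. Hecke algebra. $H$ is the $\mathbb{Z}[\Gamma]$-algebra generated by $T_s$ ($s\in S$) with relations $T_s^2=1+(v_s-v_s^{-1})T_s$ and the braid relations $T_sT_tT_s\cdots=T_tT_sT_t\cdots$ ($m_{st}$ factors, $m_{st}<\infty$); $T_w=T_{s_1}\cdots T_{s_l}$ for a reduced expression $w=s_1\cdots s_l$. For $J\subseteq S$, $W_J=\langle J\rangle$ and $H_J=\mathrm{span}\{T_w\mid w\in W_J\}$, the Hecke algebra of $(W_J,J,L|_{W_J})$. $k[\Gamma]H:=k[\Gamma]\otimes_{\mathbb{Z}[\Gamma]}H$.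 $W$-graph algebra. In $\mathbb{Z}[\Gamma]\otimes\mathbb{Z}\langle e_s,x_{s,\gamma}\mid s\in S,-L(s)<\gamma<L(s)\rangle$ (free algebra) put $j(T_s)=-v_s^{-1}e_s+v_s(1-e_s)+\sum_{\gamma}v^\gamma x_{s,\gamma}$ and write $j(T_s)j(T_t)j(T_s)\cdots-j(T_t)j(T_s)j(T_t)\cdots=\sum_\gamma v^\gamma\otimes y^\gamma(s,t)$ ($m_{st}$ factors each, $m_{st}<\infty$). $\Omega$ is the quotient of the free algebra by the relations $e_s^2=e_s$, $e_se_t=e_te_s$, $e_sx_{s,\gamma}=x_{s,\gamma}$, $x_{s,\gamma}e_s=0$, $x_{s,\gamma}=x_{s,-\gamma}$, $y^\gamma(s,t)=0$. Put $x_s=\sum_\gamma v^\gamma x_{s,\gamma}\in\mathbb{Z}[\Gamma]\Omega$. $T_s\mapsto j(T_s)$ defines an embedding $H\hookrightarrow\mathbb{Z}[\Gamma]\Omega$, regarded as an inclusion; $C_s:=T_s-v_s=-(v_s+v_s^{-1})e_s+x_s$. $\Omega_J$ is the algebra $\Omega$ for $(W_J,J,L|_{W_J})$; $k\Omega=k\otimes_{\mathbb Z}\Omega$. For a $k\Omega$-module $N$, $\mathrm{Res}_H^\Omega N$ is $k[\Gamma]\otimes_kN$ viewed as a $k[\Gamma]H$-module; similarly $\mathrm{Res}_{H_J}^{\Omega_J}$. $\mathrm{Ind}_{H_J}^H(V)=H\otimes_{H_J}V$; $\mathrm{Ind}_{H_J}^H(\phi)$ means $\mathrm{id}_H\otimes(\mathrm{id}_{k[\Gamma]}\otimes\phi)$.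 Cosets. $D_J=\{x\in W\mid l(xs)>l(x)\ \forall s\in J\}$ (minimal left coset representatives of $W_J$). For $s\in S$: $D_{J,s}^+=\{w\in D_J\mid sw>w,\ sw\in D_J\}$, $D_{J,s}^0=\{w\in D_J\mid sw>w,\ sw\notin D_J\}$, $D_{J,s}^-=\{w\in D_J\mid sw<w\}$; these partition $D_J$. For $w\in D_{J,s}^0$ one has $s^w:=w^{-1}sw\in J$ (and $L(s^w)=L(s)$). Elements $p_{x,z}$. Let $\overline{\phantom m}$-semilinear ring involution $\iota$ of $H$ be given by $\iota(T_s)=T_s^{-1}$ and write $\iota(T_z)=\sum_wR_{w,z}T_w$. For $x,z\in D_J$ put $r_{x,z}=\sum_{y\in W_J}R_{xy,z}T_y\in H_J\subseteq\mathbb{Z}[\Gamma]\Omega_J$. Then $(p_{x,z})_{x,z\in D_J}$ is the unique family in $\mathbb{Z}[\Gamma_{\ge0}]\Omega_J$ with $p_{z,z}=1$, $p_{x,z}=0$ unless $x\le z$, $p_{x,z}\in\mathbb{Z}[\Gamma_{>0}]\Omega_J$ for $x<z$, and $p_{x,z}=\sum_{x\le y\le z}r_{x,y}\overline{p_{y,z}}$. Elements $\mu_{x,z}^s$. $(\mu_{x,z}^s)_{x,z\in D_J,s\in S}$ is the unique family in $\mathbb{Z}[\Gamma]\Omega_J$ such that (i) $\mu_{x,z}^s=0$ unless $x<z$, $z\in D_{J,s}^+\cup D_{J,s}^0$ and $x\in D_{J,s}^0\cup D_{J,s}^-$; (ii) $\overline{\mu_{x,z}^s}=\mu_{x,z}^s$;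 (iii) if $z\in D_{J,s}^+\cup D_{J,s}^0$ and $x\in D_{J,s}^0\cup D_{J,s}^-$ then $\mu_{x,z}^s+R+\sum_{x<y<z}p_{x,y}\mu_{y,z}^s\in\mathbb{Z}[\Gamma_{>0}]\Omega_J$, where $R=-C_{s^x}p_{x,z}$ if $z\in D_{J,s}^+,x\in D_{J,s}^0$; $R=v_s^{-1}p_{x,z}$ if $z\in D_{J,s}^+,x\in D_{J,s}^-$; $R=p_{x,z}C_{s^z}-C_{s^x}p_{x,z}$ if $z\in D_{J,s}^0,x\in D_{J,s}^0$; $R=p_{x,z}C_{s^z}+v_s^{-1}p_{x,z}$ if $z\in D_{J,s}^0,x\in D_{J,s}^-$. Write $\mu^s_{x,z}=\sum_{-L(s)<\gamma<L(s)}\mu^{s,\gamma}_{x,z}v^\gamma$ with $\mu_{x,z}^{s,\gamma}\in\Omega_J$ (no other exponents occur). Howlett–Yin induction. For a $k\Omega_J$-module $M$, $\mathrm{HY}_J^S(M)=\bigoplus_{w\in D_J}M$ as a $k$-module, with elements of the $w$-component written $w|m$, and with $k\Omega$-module structure: $e_s\cdot z|m=0$, $z|e_{s^z}m$, $z|m$ for $z\in D_{J,s}^+,D_{J,s}^0,D_{J,s}^-$ respectively; $x_{s,\gamma}\cdot z|m=\sum_{x<z}x|\mu_{x,z}^{s,\gamma}m+\delta_{\gamma,0}\,sz|m$ for $z\in D_{J,s}^+$, $=\sum_{x<z}x|\mu_{x,z}^{s,\gamma}m+z|x_{s^z,\gamma}m$ for $z\in D_{J,s}^0$, and $=0$ for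 $z\in D_{J,s}^-$. The canonicalisation $c_M:\mathrm{Res}_H^\Omega\mathrm{HY}_J^S(M)\to\mathrm{Ind}_{H_J}^H\mathrm{Res}_{H_J}^{\Omega_J}(M)$, $z|m\mapsto\sum_{y\in D_J}T_y\otimes p_{y,z}m$ (extended $k[\Gamma]$-linearly), is an isomorphism of $k[\Gamma]H$-modules. *)

theory Defs
  imports
    "HOL-Library.Poly_Mapping"
    "HOL-Algebra.Multiplicative_Group"
    "HOL-Algebra.Generated_Groups"
begin

section \<open>Coxeter groups\<close>

definition word_prod :: "('w, 'b) monoid_scheme \<Rightarrow> 'w list \<Rightarrow> 'w" where
  "word_prod W ws = foldr (\<lambda>s w. s \<otimes>\<^bsub>W\<^esub> w) ws \<one>\<^bsub>W\<^esub>"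

text \<open>\<open>group.ord\<close> is \<open>0\<close> for elements of infinite order, so \<open>m\<^sub>s\<^sub>t < \<infinity>\<close> reads \<open>cox_m W s t > 0\<close>.\<close>

definition cox_m :: "('w, 'b) monoid_scheme \<Rightarrow> 'w \<Rightarrow> 'w \<Rightarrow> nat" where
  "cox_m W s t = group.ord W (s \<otimes>\<^bsub>W\<^esub> t)"

text \<open>Equality of words in the group presented by \<open>(s t)\<^bsup>m(s,t)\<^esup> = 1\<close>. As \<open>s = t\<close> gives
  \<open>s s = 1\<close>, inverse letters are not needed.\<close>

inductive cox_eq :: "('w, 'b) monoid_scheme \<Rightarrow> 'w set \<Rightarrow> 'w list \<Rightarrow> 'w list \<Rightarrow> bool"
  for W :: "('w, 'b) monoid_scheme" and S :: "'w set" where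
  rel: "\<lbrakk>s \<in> S; t \<in> S; cox_m W s t > 0; us \<in> lists S; vs \<in> lists S\<rbrakk> \<Longrightarrow>
    cox_eq W S (us @ concat (replicate (cox_m W s t) [s, t]) @ vs) (us @ vs)"
| refl: "us \<in> lists S \<Longrightarrow> cox_eq W S us us"
| sym: "cox_eq W S us vs \<Longrightarrow> cox_eq W S vs us"
| trans: "cox_eq W S us vs \<Longrightarrow> cox_eq W S vs ws \<Longrightarrow> cox_eq W S us ws"

locale coxeter_system = group W for W :: "('w, 'b) monoid_scheme" (structure) +
  fixes S :: "'w set"
  assumes S_subset: "S \<subseteq> carrier W"
    and S_generates: "generate W S = carrier W"
    and S_involutive: "s \<in> S \<Longrightarrow> s \<noteq> \<one> \<and> s \<otimes> s = \<one>"
    and S_presents: "\<lbrakk>us \<in> lists S; vs \<in> lists S; word_prod W us = word_prod W vs\<rbrakk> \<Longrightarrow>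
      cox_eq W S us vs"

definition cox_len :: "('w, 'b) monoid_scheme \<Rightarrow> 'w set \<Rightarrow> 'w \<Rightarrow> nat" where
  "cox_len W S w = (LEAST n. \<exists>ws\<in>lists S. length ws = n \<and> word_prod W ws = w)"

definition reduced_word :: "('w, 'b) monoid_scheme \<Rightarrow> 'w set \<Rightarrow> 'w \<Rightarrow> 'w list \<Rightarrow> bool" where
  "reduced_word W S w ws \<longleftrightarrow> ws \<in> lists S \<and> word_prod W ws = w \<and> length ws = cox_len W S w"

definition cox_reflections :: "('w, 'b) monoid_scheme \<Rightarrow> 'w set \<Rightarrow> 'w set" where
  "cox_reflections W S = {w \<otimes>\<^bsub>W\<^esub> s \<otimes>\<^bsub>W\<^esub> inv\<^bsub>W\<^esub> w | w s. w \<in> carrier W \<and> s \<in> S}"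

definition bruhat_le :: "('w, 'b) monoid_scheme \<Rightarrow> 'w set \<Rightarrow> 'w \<Rightarrow> 'w \<Rightarrow> bool" where
  "bruhat_le W S = (\<lambda>u w. u \<in> carrier W \<and> cox_len W S u < cox_len W S w \<and>
     (\<exists>t\<in>cox_reflections W S. w = u \<otimes>\<^bsub>W\<^esub> t))\<^sup>*\<^sup>*"

definition bruhat_less :: "('w, 'b) monoid_scheme \<Rightarrow> 'w set \<Rightarrow> 'w \<Rightarrow> 'w \<Rightarrow> bool" where
  "bruhat_less W S x z \<longleftrightarrow> bruhat_le W S x z \<and> x \<noteq> z"

definition pos_weight_function ::
    "('w, 'b) monoid_scheme \<Rightarrow> 'w set \<Rightarrow> ('w \<Rightarrow> int) \<Rightarrow> bool" where
  "pos_weight_function W S L \<longleftrightarrow>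
    (\<forall>x\<in>carrier W. \<forall>y\<in>carrier W.
      cox_len W S (x \<otimes>\<^bsub>W\<^esub> y) = cox_len W S x + cox_len W S y \<longrightarrow> L (x \<otimes>\<^bsub>W\<^esub> y) = L x + L y) \<and>
    (\<forall>s\<in>S. L s > 0)"

definition parabolic :: "('w, 'b) monoid_scheme \<Rightarrow> 'w set \<Rightarrow> ('w, 'b) monoid_scheme" where
  "parabolic W J = W\<lparr>carrier := generate W J\<rparr>"

definition coset_reps :: "('w, 'b) monoid_scheme \<Rightarrow> 'w set \<Rightarrow> 'w set \<Rightarrow> 'w set" where
  "coset_reps W S J = {x \<in> carrier W. \<forall>s\<in>J. cox_len W S (x \<otimes>\<^bsub>W\<^esub> s) > cox_len W S x}"

definition reps_plus :: "('w, 'b) monoid_scheme \<Rightarrow> 'w set \<Rightarrow> 'w set \<Rightarrow> 'w \<Rightarrow> 'w set" where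
  "reps_plus W S J s = {w \<in> coset_reps W S J.
     cox_len W S (s \<otimes>\<^bsub>W\<^esub> w) > cox_len W S w \<and> s \<otimes>\<^bsub>W\<^esub> w \<in> coset_reps W S J}"

definition reps_zero :: "('w, 'b) monoid_scheme \<Rightarrow> 'w set \<Rightarrow> 'w set \<Rightarrow> 'w \<Rightarrow> 'w set" where
  "reps_zero W S J s = {w \<in> coset_reps W S J.
     cox_len W S (s \<otimes>\<^bsub>W\<^esub> w) > cox_len W S w \<and> s \<otimes>\<^bsub>W\<^esub> w \<notin> coset_reps W S J}"

definition reps_minus :: "('w, 'b) monoid_scheme \<Rightarrow> 'w set \<Rightarrow> 'w set \<Rightarrow> 'w \<Rightarrow> 'w set" where
  "reps_minus W S J s = {w \<in> coset_reps W S J. cox_len W S (s \<otimes>\<^bsub>W\<^esub> w) < cox_len W S w}"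

definition conj_by :: "('w, 'b) monoid_scheme \<Rightarrow> 'w \<Rightarrow> 'w \<Rightarrow> 'w" where
  "conj_by W s w = inv\<^bsub>W\<^esub> w \<otimes>\<^bsub>W\<^esub> s \<otimes>\<^bsub>W\<^esub> w"


section \<open>Laurent polynomials and presented algebras\<close>

text \<open>\<open>A laurent\<close> is \<open>\<int>[\<Gamma>] \<otimes> A\<close> for \<open>\<Gamma> = \<int>\<close>; \<open>v\<^sup>\<gamma> \<otimes> a\<close> is \<open>Poly_Mapping.single \<gamma> a\<close>. For a ring
  \<open>A\<close> the library's convolution product makes it a ring in which \<open>v\<close> is central.\<close>

type_synonym 'a laurent = "int \<Rightarrow>\<^sub>0 'a"

abbreviation vmono :: "int \<Rightarrow> 'a::zero \<Rightarrow> 'a laurent" where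
  "vmono \<equiv> Poly_Mapping.single"

abbreviation vpow :: "int \<Rightarrow> 'a::zero_neq_one laurent" where
  "vpow \<gamma> \<equiv> Poly_Mapping.single \<gamma> 1"

definition bar :: "'a::zero laurent \<Rightarrow> 'a laurent" where
  "bar f = Poly_Mapping.map_key uminus f"

definition exponents_ge0 :: "'a::zero laurent \<Rightarrow> bool" where
  "exponents_ge0 f \<longleftrightarrow> (\<forall>\<gamma>\<in>Poly_Mapping.keys f. \<gamma> \<ge> 0)"

definition exponents_gt0 :: "'a::zero laurent \<Rightarrow> bool" where
  "exponents_gt0 f \<longleftrightarrow> (\<forall>\<gamma>\<in>Poly_Mapping.keys f. \<gamma> > 0)"

text \<open>The free monoid; it is written additively because \<open>Poly_Mapping\<close> forms the monoid algebra
  of an additively written (not necessarily commutative) monoid.\<close>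

datatype 'g fword = Word (letters: "'g list")

instantiation fword :: (type) monoid_add
begin

definition zero_fword :: "'a fword" where "0 = Word []"

definition plus_fword :: "'a fword \<Rightarrow> 'a fword \<Rightarrow> 'a fword" where
  "u + w = Word (letters u @ letters w)"

instance by standard (simp_all add: zero_fword_def plus_fword_def)

end

type_synonym ('g, 'r) free_alg = "'g fword \<Rightarrow>\<^sub>0 'r"

definition letter :: "'g \<Rightarrow> ('g, 'r::comm_ring_1) free_alg" where
  "letter a = Poly_Mapping.single (Word [a]) 1"

definition free_on :: "'g set \<Rightarrow> ('g, 'r::comm_ring_1) free_alg set" where
  "free_on A = {f. \<forall>w\<in>Poly_Mapping.keys f. set (letters w) \<subseteq> A}"

inductive_set free_ideal :: "'g set \<Rightarrow> ('g, 'r::comm_ring_1) free_alg set \<Rightarrow> ('g, 'r) free_alg set"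
  for A :: "'g set" and Rel :: "('g, 'r) free_alg set" where
  zero: "0 \<in> free_ideal A Rel"
| rel: "\<lbrakk>r \<in> Rel; a \<in> free_on A; b \<in> free_on A\<rbrakk> \<Longrightarrow> a * r * b \<in> free_ideal A Rel"
| add: "\<lbrakk>f \<in> free_ideal A Rel; g \<in> free_ideal A Rel\<rbrakk> \<Longrightarrow> f + g \<in> free_ideal A Rel"

text \<open>The ring \<open>B\<close>, with structure map \<open>\<eta>\<close> and generators \<open>g a\<close> (\<open>a \<in> A\<close>), is the quotient of the
  free \<open>r\<close>-algebra on \<open>A\<close> by the ideal generated by \<open>Rel\<close>: the canonical map from the free algebra
  is onto with exactly this kernel. Letters outside \<open>A\<close> play no role.\<close>

definition presented_algebra ::
    "('r::comm_ring_1 \<Rightarrow> 'b::ring_1) \<Rightarrow> 'g set \<Rightarrow> ('g, 'r) free_alg set \<Rightarrow> ('g \<Rightarrow> 'b) \<Rightarrow> bool" where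
  "presented_algebra \<eta> A Rel g \<longleftrightarrow> (\<exists>\<pi>.
     (\<forall>f\<in>free_on A. \<forall>f'\<in>free_on A. \<pi> (f + f') = \<pi> f + \<pi> f' \<and> \<pi> (f * f') = \<pi> f * \<pi> f') \<and>
     \<pi> 1 = 1 \<and>
     (\<forall>c. \<pi> (Poly_Mapping.single 0 c) = \<eta> c) \<and>
     (\<forall>a\<in>A. \<pi> (letter a) = g a) \<and>
     \<pi> ` free_on A = UNIV \<and>
     (\<forall>f\<in>free_on A. \<pi> f = 0 \<longleftrightarrow> f \<in> free_ideal A Rel))"

definition alternating :: "'a::ring_1 \<Rightarrow> 'a \<Rightarrow> nat \<Rightarrow> 'a" where
  "alternating a b m = prod_list (map (\<lambda>i. if even i then a else b) [0..<m])"


section \<open>Hecke algebras\<close>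

definition hecke_relations ::
    "('w, 'b) monoid_scheme \<Rightarrow> 'w set \<Rightarrow> ('w \<Rightarrow> int) \<Rightarrow> ('w, int laurent) free_alg set" where
  "hecke_relations W S L =
    {letter s * letter s - 1 - Poly_Mapping.single 0 (vpow (L s) - vpow (- L s)) * letter s | s.
       s \<in> S} \<union>
    {alternating (letter s) (letter t) (cox_m W s t) - alternating (letter t) (letter s) (cox_m W s t)
       | s t. s \<in> S \<and> t \<in> S \<and> cox_m W s t > 0}"

definition is_hecke_algebra :: "('w, 'b) monoid_scheme \<Rightarrow> 'w set \<Rightarrow> ('w \<Rightarrow> int) \<Rightarrow>
    (int laurent \<Rightarrow> 'h::ring_1) \<Rightarrow> ('w \<Rightarrow> 'h) \<Rightarrow> bool" where
  "is_hecke_algebra W S L \<eta> T \<longleftrightarrow> presented_algebra \<eta> S (hecke_relations W S L) T"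

text \<open>By Matsumoto's theorem the choice of reduced expression is immaterial.\<close>

definition hecke_T :: "('w, 'b) monoid_scheme \<Rightarrow> 'w set \<Rightarrow> ('w \<Rightarrow> 'h::ring_1) \<Rightarrow> 'w \<Rightarrow> 'h" where
  "hecke_T W S T w = prod_list (map T (SOME ws. reduced_word W S w ws))"

definition hecke_parabolic :: "('w, 'b) monoid_scheme \<Rightarrow> 'w set \<Rightarrow> 'w set \<Rightarrow>
    (int laurent \<Rightarrow> 'h::ring_1) \<Rightarrow> ('w \<Rightarrow> 'h) \<Rightarrow> 'h set" where
  "hecke_parabolic W S J \<eta> T =
    {\<Sum>w\<in>A. \<eta> (c w) * hecke_T W S T w | A c. finite A \<and> A \<subseteq> generate W J}"


section \<open>The W-graph algebra\<close>

datatype 'w wgen = Egen 'w | Xgen 'w int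

definition wgraph_alphabet :: "'w set \<Rightarrow> ('w \<Rightarrow> int) \<Rightarrow> 'w wgen set" where
  "wgraph_alphabet S L = Egen ` S \<union> {Xgen s \<gamma> | s \<gamma>. s \<in> S \<and> - L s < \<gamma> \<and> \<gamma> < L s}"

definition jT :: "('w \<Rightarrow> int) \<Rightarrow> ('w wgen \<Rightarrow> 'a::ring_1) \<Rightarrow> 'w \<Rightarrow> 'a laurent" where
  "jT L g s = - vmono (- L s) (g (Egen s)) + vmono (L s) (1 - g (Egen s)) +
     (\<Sum>\<gamma>\<in>{- L s<..<L s}. vmono \<gamma> (g (Xgen s \<gamma>)))"

definition wgraph_relations ::
    "('w, 'b) monoid_scheme \<Rightarrow> 'w set \<Rightarrow> ('w \<Rightarrow> int) \<Rightarrow> ('w wgen, int) free_alg set" where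
  "wgraph_relations W S L =
    {letter (Egen s) * letter (Egen s) - letter (Egen s) | s. s \<in> S} \<union>
    {letter (Egen s) * letter (Egen t) - letter (Egen t) * letter (Egen s) | s t.
       s \<in> S \<and> t \<in> S} \<union>
    {letter (Egen s) * letter (Xgen s \<gamma>) - letter (Xgen s \<gamma>) | s \<gamma>.
       s \<in> S \<and> - L s < \<gamma> \<and> \<gamma> < L s} \<union>
    {letter (Xgen s \<gamma>) * letter (Egen s) | s \<gamma>. s \<in> S \<and> - L s < \<gamma> \<and> \<gamma> < L s} \<union>
    {letter (Xgen s \<gamma>) - letter (Xgen s (- \<gamma>)) | s \<gamma>. s \<in> S \<and> - L s < \<gamma> \<and> \<gamma> < L s} \<union>
    {Poly_Mapping.lookup
        (alternating (jT L letter s) (jT L letter t) (cox_m W s t) -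
         alternating (jT L letter t) (jT L letter s) (cox_m W s t)) \<gamma>
       | s t \<gamma>. s \<in> S \<and> t \<in> S \<and> cox_m W s t > 0}"

definition is_wgraph_algebra :: "('w, 'b) monoid_scheme \<Rightarrow> 'w set \<Rightarrow> ('w \<Rightarrow> int) \<Rightarrow>
    ('w wgen \<Rightarrow> 'o::ring_1) \<Rightarrow> bool" where
  "is_wgraph_algebra W S L g \<longleftrightarrow>
     presented_algebra of_int (wgraph_alphabet S L) (wgraph_relations W S L) g"

text \<open>\<open>j\<close> restricted to the subalgebra \<open>HJ\<close> of \<open>H\<close> is the \<open>\<int>[\<Gamma>]\<close>-algebra map with
  \<open>T\<^sub>s \<mapsto> j(T\<^sub>s)\<close> for \<open>s \<in> J\<close>.\<close>

definition is_hecke_inclusion :: "'h set \<Rightarrow> 'w set \<Rightarrow> ('w \<Rightarrow> int) \<Rightarrow> (int laurent \<Rightarrow> 'h::ring_1) \<Rightarrow>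
    ('w \<Rightarrow> 'h) \<Rightarrow> ('w wgen \<Rightarrow> 'o::ring_1) \<Rightarrow> ('h \<Rightarrow> 'o laurent) \<Rightarrow> bool" where
  "is_hecke_inclusion HJ J L \<eta> T g j \<longleftrightarrow>
     (\<forall>a\<in>HJ. \<forall>b\<in>HJ. j (a + b) = j a + j b \<and> j (a * b) = j a * j b) \<and>
     (\<forall>q. j (\<eta> q) = Poly_Mapping.map of_int q) \<and>
     (\<forall>s\<in>J. j (T s) = jT L g s)"

text \<open>\<open>C\<^sub>s = T\<^sub>s - v\<^sub>s\<close> inside \<open>\<int>[\<Gamma>]\<Omega>\<close>.\<close>

definition jC :: "('w \<Rightarrow> int) \<Rightarrow> ('w wgen \<Rightarrow> 'a::ring_1) \<Rightarrow> 'w \<Rightarrow> 'a laurent" where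
  "jC L g s = jT L g s - vpow (L s)"


section \<open>The elements p and mu\<close>

definition is_hecke_bar :: "'w set \<Rightarrow> (int laurent \<Rightarrow> 'h::ring_1) \<Rightarrow> ('w \<Rightarrow> 'h) \<Rightarrow> ('h \<Rightarrow> 'h) \<Rightarrow> bool" where
  "is_hecke_bar S \<eta> T \<iota> \<longleftrightarrow>
     (\<forall>a b. \<iota> (a + b) = \<iota> a + \<iota> b \<and> \<iota> (a * b) = \<iota> a * \<iota> b) \<and>
     (\<forall>q. \<iota> (\<eta> q) = \<eta> (bar q)) \<and>
     (\<forall>s\<in>S. \<iota> (T s) * T s = 1 \<and> T s * \<iota> (T s) = 1)"

definition is_R_family :: "('w, 'b) monoid_scheme \<Rightarrow> 'w set \<Rightarrow> (int laurent \<Rightarrow> 'h::ring_1) \<Rightarrow>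
    ('w \<Rightarrow> 'h) \<Rightarrow> ('h \<Rightarrow> 'h) \<Rightarrow> ('w \<Rightarrow> 'w \<Rightarrow> int laurent) \<Rightarrow> bool" where
  "is_R_family W S \<eta> T \<iota> R \<longleftrightarrow> (\<forall>z\<in>carrier W.
     finite {w \<in> carrier W. R w z \<noteq> 0} \<and>
     \<iota> (hecke_T W S T z) = (\<Sum>w\<in>{w \<in> carrier W. R w z \<noteq> 0}. \<eta> (R w z) * hecke_T W S T w))"

definition rel_r :: "('w, 'b) monoid_scheme \<Rightarrow> 'w set \<Rightarrow> 'w set \<Rightarrow> (int laurent \<Rightarrow> 'h::ring_1) \<Rightarrow>
    ('w \<Rightarrow> 'h) \<Rightarrow> ('w \<Rightarrow> 'w \<Rightarrow> int laurent) \<Rightarrow> 'w \<Rightarrow> 'w \<Rightarrow> 'h" where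
  "rel_r W S J \<eta> T R x z =
     (\<Sum>y\<in>{y \<in> generate W J. R (x \<otimes>\<^bsub>W\<^esub> y) z \<noteq> 0}. \<eta> (R (x \<otimes>\<^bsub>W\<^esub> y) z) * hecke_T W S T y)"

text \<open>Here \<open>r x y\<close> is \<open>r\<^sub>x\<^sub>,\<^sub>y\<close> as an element of \<open>\<int>[\<Gamma>]\<Omega>\<^sub>J\<close>.\<close>

definition is_p_family :: "('w, 'b) monoid_scheme \<Rightarrow> 'w set \<Rightarrow> 'w set \<Rightarrow>
    ('w \<Rightarrow> 'w \<Rightarrow> 'o::ring_1 laurent) \<Rightarrow> ('w \<Rightarrow> 'w \<Rightarrow> 'o laurent) \<Rightarrow> bool" where
  "is_p_family W S J r p \<longleftrightarrow> (\<forall>x\<in>coset_reps W S J. \<forall>z\<in>coset_reps W S J.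
     exponents_ge0 (p x z) \<and>
     p z z = 1 \<and>
     (\<not> bruhat_le W S x z \<longrightarrow> p x z = 0) \<and>
     (bruhat_less W S x z \<longrightarrow> exponents_gt0 (p x z)) \<and>
     p x z = (\<Sum>y\<in>{y \<in> coset_reps W S J. bruhat_le W S x y \<and> bruhat_le W S y z}.
       r x y * bar (p y z)))"

definition mu_remainder :: "('w, 'b) monoid_scheme \<Rightarrow> 'w set \<Rightarrow> 'w set \<Rightarrow> ('w \<Rightarrow> int) \<Rightarrow>
    ('w wgen \<Rightarrow> 'o::ring_1) \<Rightarrow> ('w \<Rightarrow> 'w \<Rightarrow> 'o laurent) \<Rightarrow> 'w \<Rightarrow> 'w \<Rightarrow> 'w \<Rightarrow> 'o laurent" where
  "mu_remainder W S J L g p s x z =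
    (if z \<in> reps_plus W S J s
     then if x \<in> reps_zero W S J s
          then - (jC L g (conj_by W s x) * p x z)
          else vpow (- L s) * p x z
     else if x \<in> reps_zero W S J s
          then p x z * jC L g (conj_by W s z) - jC L g (conj_by W s x) * p x z
          else p x z * jC L g (conj_by W s z) + vpow (- L s) * p x z)"

definition is_mu_family :: "('w, 'b) monoid_scheme \<Rightarrow> 'w set \<Rightarrow> 'w set \<Rightarrow> ('w \<Rightarrow> int) \<Rightarrow>
    ('w wgen \<Rightarrow> 'o::ring_1) \<Rightarrow> ('w \<Rightarrow> 'w \<Rightarrow> 'o laurent) \<Rightarrow> ('w \<Rightarrow> 'w \<Rightarrow> 'w \<Rightarrow> 'o laurent) \<Rightarrow> bool" where
  "is_mu_family W S J L g p \<mu> \<longleftrightarrow>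
    (\<forall>s\<in>S. \<forall>x\<in>coset_reps W S J. \<forall>z\<in>coset_reps W S J.
      (\<not> (bruhat_less W S x z \<and>
          z \<in> reps_plus W S J s \<union> reps_zero W S J s \<and>
          x \<in> reps_zero W S J s \<union> reps_minus W S J s) \<longrightarrow> \<mu> s x z = 0) \<and>
      bar (\<mu> s x z) = \<mu> s x z \<and>
      (z \<in> reps_plus W S J s \<union> reps_zero W S J s \<and> x \<in> reps_zero W S J s \<union> reps_minus W S J s \<longrightarrow>
        exponents_gt0 (\<mu> s x z + mu_remainder W S J L g p s x z +
          (\<Sum>y\<in>{y \<in> coset_reps W S J. bruhat_less W S x y \<and> bruhat_less W S y z}.
             p x y * \<mu> s y z))))"


section \<open>Modules\<close>

text \<open>A module over \<open>k \<otimes>\<^sub>\<int> A\<close> is a \<open>k\<close>-module (\<open>smul\<close>) with a \<open>k\<close>-linear action \<open>act\<close> of \<open>A\<close>; likewise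
  a \<open>k[\<Gamma>]H\<close>-module is a \<open>k[\<Gamma>]\<close>-module with a compatible action of \<open>H\<close>. The carrier is a subgroup of
  an ambient abelian group. The sort of \<open>k\<close> is that of commutative rings with \<open>1\<close>, without the
  requirement \<open>0 \<noteq> 1\<close> built into \<open>comm_ring_1\<close>.\<close>

record ('k, 'a, 'm) kmod = "'m partial_object" +
  smul :: "'k \<Rightarrow> 'm \<Rightarrow> 'm"
  act :: "'a \<Rightarrow> 'm \<Rightarrow> 'm"

definition is_kmod :: "('k::{comm_ring, comm_monoid_mult}, 'a::ring_1, 'm::ab_group_add) kmod \<Rightarrow> bool" where
  "is_kmod M \<longleftrightarrow>
     0 \<in> carrier M \<and>
     (\<forall>u\<in>carrier M. \<forall>w\<in>carrier M. u + w \<in> carrier M \<and> - u \<in> carrier M) \<and>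
     (\<forall>c. \<forall>u\<in>carrier M. smul M c u \<in> carrier M) \<and>
     (\<forall>c. \<forall>u\<in>carrier M. \<forall>w\<in>carrier M. smul M c (u + w) = smul M c u + smul M c w) \<and>
     (\<forall>c d. \<forall>u\<in>carrier M. smul M (c + d) u = smul M c u + smul M d u \<and>
        smul M (c * d) u = smul M c (smul M d u)) \<and>
     (\<forall>u\<in>carrier M. smul M 1 u = u) \<and>
     (\<forall>a. \<forall>u\<in>carrier M. act M a u \<in> carrier M) \<and>
     (\<forall>a. \<forall>u\<in>carrier M. \<forall>w\<in>carrier M. act M a (u + w) = act M a u + act M a w) \<and>
     (\<forall>a b. \<forall>u\<in>carrier M. act M (a + b) u = act M a u + act M b u \<and>
        act M (a * b) u = act M a (act M b u)) \<and>
     (\<forall>u\<in>carrier M. act M 1 u = u) \<and>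
     (\<forall>a c. \<forall>u\<in>carrier M. act M a (smul M c u) = smul M c (act M a u))"

definition kmod_hom :: "('k, 'a, 'm::ab_group_add) kmod \<Rightarrow> ('k, 'a, 'n::ab_group_add) kmod \<Rightarrow>
    ('m \<Rightarrow> 'n) \<Rightarrow> bool" where
  "kmod_hom M N f \<longleftrightarrow>
     (\<forall>u\<in>carrier M. f u \<in> carrier N) \<and>
     (\<forall>u\<in>carrier M. \<forall>w\<in>carrier M. f (u + w) = f u + f w) \<and>
     (\<forall>c. \<forall>u\<in>carrier M. f (smul M c u) = smul N c (f u)) \<and>
     (\<forall>a. \<forall>u\<in>carrier M. f (act M a u) = act N a (f u))"

definition kmod_iso :: "('k, 'a, 'm::ab_group_add) kmod \<Rightarrow> ('k, 'a, 'n::ab_group_add) kmod \<Rightarrow>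
    ('m \<Rightarrow> 'n) \<Rightarrow> bool" where
  "kmod_iso M N f \<longleftrightarrow> kmod_hom M N f \<and> bij_betw f (carrier M) (carrier N)"

text \<open>The component at a morphism of a natural isomorphism of functors into modules: \<open>f\<close> and \<open>g\<close> are
  the images of the morphism, \<open>c\<close> and \<open>c'\<close> the isomorphisms at its source and target.\<close>

definition natural_iso_square :: "('k, 'a, 'm::ab_group_add) kmod \<Rightarrow> ('k, 'a, 'n::ab_group_add) kmod \<Rightarrow>
    ('k, 'a, 'p::ab_group_add) kmod \<Rightarrow> ('k, 'a, 'q::ab_group_add) kmod \<Rightarrow>
    ('m \<Rightarrow> 'n) \<Rightarrow> ('p \<Rightarrow> 'q) \<Rightarrow> ('m \<Rightarrow> 'p) \<Rightarrow> ('n \<Rightarrow> 'q) \<Rightarrow> bool" where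
  "natural_iso_square A A' B B' f g c c' \<longleftrightarrow>
     kmod_iso A B c \<and> kmod_iso A' B' c' \<and> kmod_hom A A' f \<and> kmod_hom B B' g \<and>
     (\<forall>u\<in>carrier A. c' (f u) = g (c u))"

text \<open>The pairing \<open>\<int>[\<Gamma>]A \<times> \<int>[\<Gamma>]M \<rightarrow> \<int>[\<Gamma>]N\<close>, \<open>(v\<^sup>\<alpha> a, v\<^sup>\<beta> m) \<mapsto> v\<^sup>\<alpha>\<^sup>+\<^sup>\<beta> b a m\<close>, extending \<open>b\<close>.\<close>

definition laurent_pair :: "('a::zero \<Rightarrow> 'm::zero \<Rightarrow> 'n::comm_monoid_add) \<Rightarrow> 'a laurent \<Rightarrow> 'm laurent \<Rightarrow> 'n laurent" where
  "laurent_pair b q f = (\<Sum>\<alpha>\<in>Poly_Mapping.keys q. \<Sum>\<beta>\<in>Poly_Mapping.keys f.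
     vmono (\<alpha> + \<beta>) (b (Poly_Mapping.lookup q \<alpha>) (Poly_Mapping.lookup f \<beta>)))"

text \<open>\<open>k[\<Gamma>] \<otimes>\<^sub>k N\<close>, on which a Hecke algebra acts through \<open>j\<close> into \<open>\<int>[\<Gamma>]\<Omega>\<close>.\<close>

definition hecke_Res :: "('h \<Rightarrow> 'o::ring_1 laurent) \<Rightarrow> ('k::comm_ring, 'o, 'm::ab_group_add) kmod \<Rightarrow>
    ('k laurent, 'h, 'm laurent) kmod" where
  "hecke_Res j N =
    \<lparr>carrier = {f. Poly_Mapping.range f \<subseteq> carrier N},
     smul = laurent_pair (smul N),
     act = (\<lambda>h. laurent_pair (act N) (j h))\<rparr>"

text \<open>\<open>id \<otimes> f\<close> on \<open>k[\<Gamma>] \<otimes>\<^sub>k N\<close>.\<close>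

definition laurent_map :: "('m::zero \<Rightarrow> 'n::zero) \<Rightarrow> 'm laurent \<Rightarrow> 'n laurent" where
  "laurent_map f = Poly_Mapping.map f"


section \<open>Induction of Hecke algebra modules\<close>

text \<open>Integer linear combinations of pairs \<open>(h, u)\<close>; \<open>tensor_relations\<close> is the subgroup by which
  \<open>H \<otimes>\<^bsub>HJ\<^esub> V\<close> is the quotient.\<close>

definition pure_pair :: "'h \<Rightarrow> 'v \<Rightarrow> ('h \<times> 'v) \<Rightarrow>\<^sub>0 int" where
  "pure_pair h u = Poly_Mapping.single (h, u) 1"

inductive_set tensor_relations ::
    "'h set \<Rightarrow> ('k, 'h::ring_1, 'v::ab_group_add) kmod \<Rightarrow> (('h \<times> 'v) \<Rightarrow>\<^sub>0 int) set"
  for HJ :: "'h set" and V :: "('k, 'h, 'v) kmod" where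
  zero: "0 \<in> tensor_relations HJ V"
| add_left: "u \<in> carrier V \<Longrightarrow>
    pure_pair (h + h') u - pure_pair h u - pure_pair h' u \<in> tensor_relations HJ V"
| add_right: "\<lbrakk>u \<in> carrier V; u' \<in> carrier V\<rbrakk> \<Longrightarrow>
    pure_pair h (u + u') - pure_pair h u - pure_pair h u' \<in> tensor_relations HJ V"
| balanced: "\<lbrakk>a \<in> HJ; u \<in> carrier V\<rbrakk> \<Longrightarrow>
    pure_pair (h * a) u - pure_pair h (act V a u) \<in> tensor_relations HJ V"
| diff: "\<lbrakk>f \<in> tensor_relations HJ V; g \<in> tensor_relations HJ V\<rbrakk> \<Longrightarrow>
    f - g \<in> tensor_relations HJ V"

definition is_tensor :: "'h set \<Rightarrow> ('k, 'h::ring_1, 'v::ab_group_add) kmod \<Rightarrow>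
    ('h \<Rightarrow> 'v \<Rightarrow> 't::ab_group_add) \<Rightarrow> bool" where
  "is_tensor HJ V tens \<longleftrightarrow> (\<exists>\<pi>.
     additive \<pi> \<and>
     (\<forall>h. \<forall>u\<in>carrier V. \<pi> (pure_pair h u) = tens h u) \<and>
     \<pi> ` {f. Poly_Mapping.keys f \<subseteq> UNIV \<times> carrier V} = UNIV \<and>
     (\<forall>f. Poly_Mapping.keys f \<subseteq> UNIV \<times> carrier V \<longrightarrow>
        (\<pi> f = 0 \<longleftrightarrow> f \<in> tensor_relations HJ V)))"

text \<open>The additive map on \<open>H \<otimes> V\<close> with \<open>h \<otimes> u \<mapsto> g h u\<close>.\<close>

definition tensor_lift :: "('k, 'h, 'v) kmod \<Rightarrow> ('h \<Rightarrow> 'v \<Rightarrow> 't::ab_group_add) \<Rightarrow>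
    ('h \<Rightarrow> 'v \<Rightarrow> 'u::ab_group_add) \<Rightarrow> 't \<Rightarrow> 'u" where
  "tensor_lift V tens g = (THE G. additive G \<and> (\<forall>h. \<forall>u\<in>carrier V. G (tens h u) = g h u))"

definition hecke_Ind :: "('k, 'h::ring_1, 'v) kmod \<Rightarrow> ('h \<Rightarrow> 'v \<Rightarrow> 't::ab_group_add) \<Rightarrow>
    ('k, 'h, 't) kmod" where
  "hecke_Ind V tens =
    \<lparr>carrier = UNIV,
     smul = (\<lambda>c. tensor_lift V tens (\<lambda>h u. tens h (smul V c u))),
     act = (\<lambda>h'. tensor_lift V tens (\<lambda>h u. tens (h' * h) u))\<rparr>"

text \<open>\<open>Ind(\<phi>) = id \<otimes> (id \<otimes> \<phi>)\<close> for \<open>\<phi> : M \<rightarrow> M'\<close> and \<open>V = k[\<Gamma>] \<otimes>\<^sub>k M\<close>.\<close>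

definition hecke_Ind_map :: "('k, 'h, 'm::zero laurent) kmod \<Rightarrow> ('h \<Rightarrow> 'm laurent \<Rightarrow> 't::ab_group_add) \<Rightarrow>
    ('h \<Rightarrow> 'n::zero laurent \<Rightarrow> 'u::ab_group_add) \<Rightarrow> ('m \<Rightarrow> 'n) \<Rightarrow> 't \<Rightarrow> 'u" where
  "hecke_Ind_map V tens tens' \<phi> = tensor_lift V tens (\<lambda>h u. tens' h (laurent_map \<phi> u))"


section \<open>Howlett-Yin induction\<close>

text \<open>The element \<open>z|m\<close> of the direct sum is \<open>Poly_Mapping.single z m\<close>. The algebra \<open>\<Omega>\<close> being
  generated by the \<open>e\<^sub>s\<close> and \<open>x\<^sub>s\<^sub>,\<^sub>\<gamma>\<close>, the formulas below determine \<open>N\<close> on its carrier. The sums are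
  finite because lower Bruhat intervals are.\<close>

definition is_HY :: "('w, 'b) monoid_scheme \<Rightarrow> 'w set \<Rightarrow> 'w set \<Rightarrow> ('w \<Rightarrow> int) \<Rightarrow>
    ('w wgen \<Rightarrow> 'o::ring_1) \<Rightarrow> ('w wgen \<Rightarrow> 'oj::ring_1) \<Rightarrow> ('w \<Rightarrow> 'w \<Rightarrow> 'w \<Rightarrow> 'oj laurent) \<Rightarrow>
    ('k::{comm_ring, comm_monoid_mult}, 'oj, 'm::ab_group_add) kmod \<Rightarrow> ('k, 'o, 'w \<Rightarrow>\<^sub>0 'm) kmod \<Rightarrow> bool" where
  "is_HY W S J L g gJ \<mu> M N \<longleftrightarrow>
     is_kmod N \<and>
     carrier N = {f. Poly_Mapping.keys f \<subseteq> coset_reps W S J \<and> Poly_Mapping.range f \<subseteq> carrier M} \<and>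
     (\<forall>c. \<forall>f\<in>carrier N. smul N c f = Poly_Mapping.map (smul M c) f) \<and>
     (\<forall>s\<in>S. \<forall>m\<in>carrier M.
       (\<forall>z\<in>reps_plus W S J s. act N (g (Egen s)) (Poly_Mapping.single z m) = 0) \<and>
       (\<forall>z\<in>reps_zero W S J s. act N (g (Egen s)) (Poly_Mapping.single z m) =
          Poly_Mapping.single z (act M (gJ (Egen (conj_by W s z))) m)) \<and>
       (\<forall>z\<in>reps_minus W S J s. act N (g (Egen s)) (Poly_Mapping.single z m) =
          Poly_Mapping.single z m)) \<and>
     (\<forall>s\<in>S. \<forall>\<gamma>\<in>{- L s<..<L s}. \<forall>m\<in>carrier M.
       (\<forall>z\<in>reps_plus W S J s. act N (g (Xgen s \<gamma>)) (Poly_Mapping.single z m) =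
          (\<Sum>x\<in>{x \<in> coset_reps W S J. bruhat_less W S x z}.
             Poly_Mapping.single x (act M (Poly_Mapping.lookup (\<mu> s x z) \<gamma>) m)) +
          (if \<gamma> = 0 then Poly_Mapping.single (s \<otimes>\<^bsub>W\<^esub> z) m else 0)) \<and>
       (\<forall>z\<in>reps_zero W S J s. act N (g (Xgen s \<gamma>)) (Poly_Mapping.single z m) =
          (\<Sum>x\<in>{x \<in> coset_reps W S J. bruhat_less W S x z}.
             Poly_Mapping.single x (act M (Poly_Mapping.lookup (\<mu> s x z) \<gamma>) m)) +
          Poly_Mapping.single z (act M (gJ (Xgen (conj_by W s z) \<gamma>)) m)) \<and>
       (\<forall>z\<in>reps_minus W S J s. act N (g (Xgen s \<gamma>)) (Poly_Mapping.single z m) = 0))"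

definition HY_map :: "('m::zero \<Rightarrow> 'n::zero) \<Rightarrow> ('w \<Rightarrow>\<^sub>0 'm) \<Rightarrow> ('w \<Rightarrow>\<^sub>0 'n)" where
  "HY_map \<phi> = Poly_Mapping.map \<phi>"

text \<open>On \<open>v\<^sup>\<gamma> \<otimes> z|m\<close> the value is \<open>\<Sum>\<^sub>y T\<^sub>y \<otimes> p\<^sub>y\<^sub>,\<^sub>z v\<^sup>\<gamma> m\<close>; the terms with \<open>y \<le> z\<close> failing vanish and
  are left out to keep the sum finite.\<close>

definition canonicalisation :: "('w, 'b) monoid_scheme \<Rightarrow> 'w set \<Rightarrow> 'w set \<Rightarrow> ('w \<Rightarrow> 'h::ring_1) \<Rightarrow>
    ('w \<Rightarrow> 'w \<Rightarrow> 'oj::ring_1 laurent) \<Rightarrow> ('k, 'oj, 'm::ab_group_add) kmod \<Rightarrow>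
    ('h \<Rightarrow> 'm laurent \<Rightarrow> 't::ab_group_add) \<Rightarrow> ('w \<Rightarrow>\<^sub>0 'm) laurent \<Rightarrow> 't" where
  "canonicalisation W S J T p M tens F =
    (\<Sum>\<gamma>\<in>Poly_Mapping.keys F. \<Sum>z\<in>Poly_Mapping.keys (Poly_Mapping.lookup F \<gamma>).
      \<Sum>y\<in>{y \<in> coset_reps W S J. bruhat_le W S y z}.
        tens (hecke_T W S T y)
          (laurent_pair (act M) (p y z)
             (vmono \<gamma> (Poly_Mapping.lookup (Poly_Mapping.lookup F \<gamma>) z))))"

end

theory Submission
  imports Defs "HOL-Algebra.Free_Abelian_Groups"
begin

text \<open>All structure constants of \<open>HY(M)\<close> and of the canonicalisation are elements of \<open>\<int>[\<Gamma>]\<Omega>\<^sub>J\<close>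
  acting on \<open>M\<close>, so they commute with every \<open>\<Omega>\<^sub>J\<close>-linear map applied componentwise. As \<open>\<Omega>\<close> is
  generated by the \<open>e\<^sub>s\<close> and \<open>x\<^sub>s\<^sub>,\<^sub>\<gamma>\<close>, and \<open>H \<otimes> V\<close> by pure tensors, both claims reduce to such
  computations.\<close>

section \<open>Finitely supported functions\<close>

text \<open>A module is a subgroup of an ambient abelian group, and its action and the maps out of
  it are constrained on that subgroup alone. Additivity and linearity are therefore relative to a
  carrier, and summands must be shown to lie in it before a map is moved inside a sum. A second
  obstacle is that sums run over supports, while a module map may send nonzero coefficients to zero:
  the two sides of an identity then range over different index sets, which are first enlarged to a
  common one. Reduction to the generators of \<Omega> also asks that their action on each z|m be
  prescribed; the three cases in the definition of HY exhaust D_J because l(sz) never equals l(z).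
  On the side of induction, maps out of H \<otimes> V are definite descriptions, so they can be
  evaluated only once the universal property of the tensor product is established.\<close>

lemma poly_mapping_expand:
  "(\<Sum>k\<in>Poly_Mapping.keys f. Poly_Mapping.single k (Poly_Mapping.lookup f k)) = f"
  by (rule poly_mapping_eqI)
    (auto simp: lookup_sum lookup_single when_def in_keys_iff sum.delta' cong: if_cong)

lemma lookup_map: "g 0 = 0 \<Longrightarrow> Poly_Mapping.lookup (Poly_Mapping.map g f) k = g (Poly_Mapping.lookup f k)"
  by (simp add: Poly_Mapping.map.rep_eq when_def)

lemma keys_map_subset: "Poly_Mapping.keys (Poly_Mapping.map g f) \<subseteq> Poly_Mapping.keys f"
  by (auto simp: in_keys_iff Poly_Mapping.map.rep_eq)

lemma lookup_in_if_range_subset: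
  "Poly_Mapping.range f \<subseteq> C \<Longrightarrow> 0 \<in> C \<Longrightarrow> Poly_Mapping.lookup f k \<in> C"
  by (cases "k \<in> Poly_Mapping.keys f") (auto simp: in_keys_iff dest: in_keys_lookup_in_range)

text \<open>\<open>Poly_Mapping.range\<close> collects the nonzero values only, hence the condition
  on 0. In the pointwise form, closure under sums and under coefficientwise maps is checked one
  coefficient at a time.\<close>

lemma range_subset_iff_lookup:
  "0 \<in> C \<Longrightarrow> Poly_Mapping.range f \<subseteq> C \<longleftrightarrow> (\<forall>k. Poly_Mapping.lookup f k \<in> C)"
  using lookup_in_if_range_subset[of f C] by (auto simp: Poly_Mapping.range.rep_eq)

section \<open>Additive maps between subgroups\<close>

definition add_closed :: "'a::ab_group_add set \<Rightarrow> bool" where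
  "add_closed C \<longleftrightarrow> 0 \<in> C \<and> (\<forall>u\<in>C. \<forall>w\<in>C. u + w \<in> C \<and> - u \<in> C)"

text \<open>Unlike \<open>additive\<close>, which concerns a whole type, this is relative to a
  subset: outside the carrier of a module, the values of actions and homomorphisms are
  arbitrary.\<close>

definition additive_on :: "'a::ab_group_add set \<Rightarrow> ('a \<Rightarrow> 'b::ab_group_add) \<Rightarrow> bool" where
  "additive_on C g \<longleftrightarrow> (\<forall>u\<in>C. \<forall>w\<in>C. g (u + w) = g u + g w)"

lemma additive_on_zero: "add_closed C \<Longrightarrow> additive_on C g \<Longrightarrow> g 0 = 0"
  unfolding add_closed_def additive_on_def by (metis add_cancel_right_left)

lemma additive_on_minus: "add_closed C \<Longrightarrow> additive_on C g \<Longrightarrow> u \<in> C \<Longrightarrow> g (- u) = - g u"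
proof -
  assume C: "add_closed C" "additive_on C g" "u \<in> C"
  then have "g u + g (- u) = g (u + - u)" unfolding add_closed_def additive_on_def by metis
  then have "g u + g (- u) = 0" using additive_on_zero[OF C(1,2)] by simp
  then show ?thesis by (simp add: minus_unique)
qed

lemma add_closed_sum: "add_closed C \<Longrightarrow> (\<And>i. i \<in> I \<Longrightarrow> f i \<in> C) \<Longrightarrow> sum f I \<in> C"
  by (induction I rule: infinite_finite_induct) (auto simp: add_closed_def)

lemma additive_on_sum:
  assumes "add_closed C" "additive_on C g" "\<And>i. i \<in> I \<Longrightarrow> f i \<in> C"
  shows "g (sum f I) = (\<Sum>i\<in>I. g (f i))"
  using assms(3)
proof (induction I rule: infinite_finite_induct)
  case (insert x F)
  then show ?case using assms(1,2) add_closed_sum[OF assms(1), of F f]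
    by (simp add: additive_on_def)
qed (use additive_on_zero assms in auto)

lemma map_add_on:
  assumes "add_closed C" "additive_on C g" "Poly_Mapping.range f \<subseteq> C" "Poly_Mapping.range f' \<subseteq> C"
  shows "Poly_Mapping.map g (f + f') = Poly_Mapping.map g f + Poly_Mapping.map g f'"
proof (rule poly_mapping_eqI)
  have "0 \<in> C" using assms(1) by (simp add: add_closed_def)
  then show "Poly_Mapping.lookup (Poly_Mapping.map g (f + f')) k =
      Poly_Mapping.lookup (Poly_Mapping.map g f + Poly_Mapping.map g f') k" for k
    using assms additive_on_zero[OF assms(1,2)]
    by (simp add: lookup_map lookup_add additive_on_def lookup_in_if_range_subset)
qed

lemma add_closed_range:
  "add_closed C \<Longrightarrow> add_closed {f. Poly_Mapping.range f \<subseteq> C}"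
  by (auto simp: add_closed_def range_subset_iff_lookup lookup_add)

lemma additive_on_map:
  "add_closed C \<Longrightarrow> additive_on C g \<Longrightarrow>
    additive_on {f. Poly_Mapping.range f \<subseteq> C} (Poly_Mapping.map g)"
  by (simp add: additive_on_def[of "{f. Poly_Mapping.range f \<subseteq> C}"] map_add_on)

lemma range_map_subset:
  "add_closed C \<Longrightarrow> add_closed C' \<Longrightarrow> additive_on C g \<Longrightarrow> (\<And>u. u \<in> C \<Longrightarrow> g u \<in> C') \<Longrightarrow>
    Poly_Mapping.range f \<subseteq> C \<Longrightarrow> Poly_Mapping.range (Poly_Mapping.map g f) \<subseteq> C'"
  using range_subset_iff_lookup[of C' "Poly_Mapping.map g f"] additive_on_zero[of C g]
  by (simp add: add_closed_def lookup_map lookup_in_if_range_subset)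

section \<open>The pairing of Laurent polynomials\<close>

text \<open>Exponents outside the support of f contribute \<open>b a 0 = 0\<close>. This allows sums
  belonging to different Laurent polynomials to be compared over one index set.\<close>

lemma laurent_pair_widen:
  assumes "finite B" "Poly_Mapping.keys f \<subseteq> B" "\<And>a. b a 0 = 0"
  shows "laurent_pair b q f = (\<Sum>\<alpha>\<in>Poly_Mapping.keys q. \<Sum>\<beta>\<in>B.
     vmono (\<alpha> + \<beta>) (b (Poly_Mapping.lookup q \<alpha>) (Poly_Mapping.lookup f \<beta>)))"
  unfolding laurent_pair_def
  by (intro sum.cong refl sum.mono_neutral_left) (use assms in \<open>auto simp: in_keys_iff\<close>)

lemma laurent_pair_single:
  "(\<And>a. b a 0 = 0) \<Longrightarrow> laurent_pair b q (vmono \<beta> m) =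
    (\<Sum>\<alpha>\<in>Poly_Mapping.keys q. vmono (\<alpha> + \<beta>) (b (Poly_Mapping.lookup q \<alpha>) m))"
  by (subst laurent_pair_widen[of "{\<beta>}"]) auto

lemma range_laurent_pair:
  assumes "add_closed C" "\<And>a u. u \<in> C \<Longrightarrow> b a u \<in> C" "Poly_Mapping.range f \<subseteq> C"
  shows "Poly_Mapping.range (laurent_pair b q f) \<subseteq> C"
proof -
  have "0 \<in> C" using assms(1) by (simp add: add_closed_def)
  then have "vmono k (b a (Poly_Mapping.lookup f i)) \<in> {f. Poly_Mapping.range f \<subseteq> C}" for k a i
    using assms lookup_in_if_range_subset[of f C i]
    by (simp add: range_subset_iff_lookup lookup_single when_def)
  then have "laurent_pair b q f \<in> {f. Poly_Mapping.range f \<subseteq> C}"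
    unfolding laurent_pair_def by (intro add_closed_sum add_closed_range assms(1))
  then show ?thesis by simp
qed

lemma additive_on_laurent_pair:
  assumes "add_closed C" "\<And>a. additive_on C (b a)"
  shows "additive_on {f. Poly_Mapping.range f \<subseteq> C} (laurent_pair b q)"
  unfolding additive_on_def
proof (intro ballI, simp only: mem_Collect_eq)
  fix f f' :: "'a laurent"
  assume f: "Poly_Mapping.range f \<subseteq> C" "Poly_Mapping.range f' \<subseteq> C"
  \<comment> \<open>Cancellation may make the support of f + f' smaller than this union.\<close>
  let ?B = "Poly_Mapping.keys f \<union> Poly_Mapping.keys f'"
  have B: "finite ?B" "Poly_Mapping.keys f \<subseteq> ?B" "Poly_Mapping.keys f' \<subseteq> ?B"
      "Poly_Mapping.keys (f + f') \<subseteq> ?B"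
    using keys_add[of f f'] by auto
  have 0: "b a 0 = 0" for a using assms additive_on_zero by blast
  have "b a (Poly_Mapping.lookup f k + Poly_Mapping.lookup f' k) =
      b a (Poly_Mapping.lookup f k) + b a (Poly_Mapping.lookup f' k)" for a k
    using assms f by (simp add: additive_on_def lookup_in_if_range_subset add_closed_def)
  then show "laurent_pair b q (f + f') = laurent_pair b q f + laurent_pair b q f'"
    by (simp add: laurent_pair_widen[of ?B _ b, OF B(1) _ 0] B lookup_add single_add sum.distrib)
qed

text \<open>The map g passes through the double sum and intertwines b with b' in every coefficient.
  With b = \<open>smul\<close> this gives linearity over the Laurent polynomials, with b =
  \<open>act\<close> linearity over the Hecke algebra and compatibility with the elements p.\<close>

lemma laurent_map_laurent_pair:
  assumes C: "add_closed C" and g: "additive_on C g" and b: "\<And>a u. u \<in> C \<Longrightarrow> b a u \<in> C"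
    and comm: "\<And>a u. u \<in> C \<Longrightarrow> g (b a u) = b' a (g u)" and 0: "\<And>a. b' a 0 = 0"
    and f: "Poly_Mapping.range f \<subseteq> C"
  shows "laurent_map g (laurent_pair b q f) = laurent_pair b' q (laurent_map g f)"
proof -
  note D = add_closed_range[OF C] and map_add = additive_on_map[OF C g]
  have 0: "0 \<in> C" "g 0 = 0" using C additive_on_zero[OF C g] by (simp_all add: add_closed_def)
  have f': "Poly_Mapping.lookup f k \<in> C" for k using f 0 by (simp add: lookup_in_if_range_subset)
  have mem: "vmono k (b a (Poly_Mapping.lookup f i)) \<in> {f. Poly_Mapping.range f \<subseteq> C}" for k a i
    using b f' 0 by (simp add: range_subset_iff_lookup lookup_single when_def)
  have "laurent_map g (laurent_pair b q f) = (\<Sum>\<alpha>\<in>Poly_Mapping.keys q. \<Sum>\<beta>\<in>Poly_Mapping.keys f.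
      vmono (\<alpha> + \<beta>) (b' (Poly_Mapping.lookup q \<alpha>) (Poly_Mapping.lookup (laurent_map g f) \<beta>)))"
    unfolding laurent_map_def laurent_pair_def
    by (simp add: additive_on_sum[OF D map_add] add_closed_sum[OF D] mem comm f' lookup_map 0
        map_single del: mem_Collect_eq)
  \<comment> \<open>g may annihilate coefficients of f, so the sum so far can run over more
    exponents than the support of \<open>laurent_map g f\<close>.\<close>
  also have "\<dots> = laurent_pair b' q (laurent_map g f)"
    by (rule laurent_pair_widen[symmetric]) (simp_all add: laurent_map_def keys_map_subset assms)
  finally show ?thesis .
qed

text \<open>Both sides are the same triple sum in a different order, since the operators commute and
  exponents add commutatively. It shows that scalars commute with the Hecke action on a restricted
  module, which makes scalar multiplication descend to the tensor product.\<close>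

lemma laurent_pair_commute:
  assumes C: "add_closed C" and b: "\<And>a. additive_on C (b a)" "\<And>a u. u \<in> C \<Longrightarrow> b a u \<in> C"
    and b': "\<And>a. additive_on C (b' a)" "\<And>a u. u \<in> C \<Longrightarrow> b' a u \<in> C"
    and comm: "\<And>a a' u. u \<in> C \<Longrightarrow> b a (b' a' u) = b' a' (b a u)"
    and f: "Poly_Mapping.range f \<subseteq> C"
  shows "laurent_pair b q (laurent_pair b' q' f) = laurent_pair b' q' (laurent_pair b q f)"
proof -
  note D = add_closed_range[OF C]
  have 0: "0 \<in> C" "b a 0 = 0" "b' a' 0 = 0" for a a'
    using C additive_on_zero[OF C b(1)] additive_on_zero[OF C b'(1)] by (simp_all add: add_closed_def)
  have mem: "vmono k m \<in> {f. Poly_Mapping.range f \<subseteq> C}" if "m \<in> C" for k m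
    using that 0 by (simp add: range_subset_iff_lookup lookup_single when_def)
  have f': "Poly_Mapping.lookup f k \<in> C" for k using f 0 by (simp add: lookup_in_if_range_subset)
  have "laurent_pair b q (laurent_pair b' q' f) =
      (\<Sum>\<alpha>'\<in>Poly_Mapping.keys q'. \<Sum>\<beta>\<in>Poly_Mapping.keys f. \<Sum>\<alpha>\<in>Poly_Mapping.keys q.
        vmono (\<alpha> + (\<alpha>' + \<beta>)) (b (Poly_Mapping.lookup q \<alpha>)
          (b' (Poly_Mapping.lookup q' \<alpha>') (Poly_Mapping.lookup f \<beta>))))"
    unfolding laurent_pair_def[of b' q' f]
    by (simp add: additive_on_sum[OF D additive_on_laurent_pair[of C b, OF C b(1)]]
        add_closed_sum[OF D] mem b' f' laurent_pair_single 0 del: mem_Collect_eq)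
  also have "\<dots> = (\<Sum>\<alpha>\<in>Poly_Mapping.keys q. \<Sum>\<beta>\<in>Poly_Mapping.keys f. \<Sum>\<alpha>'\<in>Poly_Mapping.keys q'.
        vmono (\<alpha>' + (\<alpha> + \<beta>)) (b' (Poly_Mapping.lookup q' \<alpha>')
          (b (Poly_Mapping.lookup q \<alpha>) (Poly_Mapping.lookup f \<beta>))))"
    by (subst sum.swap, subst (2) sum.swap, subst sum.swap)
       (simp add: comm f' add.left_commute)
  also have "\<dots> = laurent_pair b' q' (laurent_pair b q f)"
    unfolding laurent_pair_def[of b q f]
    by (simp add: additive_on_sum[OF D additive_on_laurent_pair[of C b', OF C b'(1)]]
        add_closed_sum[OF D] mem b f' laurent_pair_single 0 del: mem_Collect_eq)
  finally show ?thesis .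
qed

section \<open>Presented algebras\<close>

text \<open>An element lifts to the free algebra, where it is a finite sum of scalar multiples of
  words, and words are products of letters. The quotient map carries this decomposition
  back.\<close>

lemma presented_algebra_induct [consumes 1, case_names scalar gen add mult]:
  fixes \<eta> :: "'r::comm_ring_1 \<Rightarrow> 'b::ring_1"
  assumes "presented_algebra \<eta> (A :: 'g set) Rel g"
    and scalar: "\<And>c. P (\<eta> c)" and gen: "\<And>a. a \<in> A \<Longrightarrow> P (g a)"
    and add: "\<And>x y. P x \<Longrightarrow> P y \<Longrightarrow> P (x + y)" and mult: "\<And>x y. P x \<Longrightarrow> P y \<Longrightarrow> P (x * y)"
  shows "P b"
proof -
  obtain \<pi> where hom: "\<And>f f'. f \<in> free_on A \<Longrightarrow> f' \<in> free_on A \<Longrightarrow>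
        \<pi> (f + f') = \<pi> f + \<pi> f' \<and> \<pi> (f * f') = \<pi> f * \<pi> f'"
    and scal: "\<And>c. \<pi> (Poly_Mapping.single 0 c) = \<eta> c" and gens: "\<And>a. a \<in> A \<Longrightarrow> \<pi> (letter a) = g a"
    and surj: "\<pi> ` free_on A = UNIV"
    using assms(1) unfolding presented_algebra_def by blast
  have free_single: "Poly_Mapping.single w c \<in> free_on A" if "set (letters w) \<subseteq> A" for w c
    using that by (simp add: free_on_def)
  have word: "P (\<pi> (Poly_Mapping.single (Word l) 1))" if "set l \<subseteq> A" for l
    using that
  proof (induction l)
    case Nil
    then show ?case using scal[of 1] scalar[of 1] by (simp add: zero_fword_def)
  next
    case (Cons a l)
    have "Poly_Mapping.single (Word (a # l)) (1::'r) = letter a * Poly_Mapping.single (Word l) 1"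
      by (simp add: letter_def mult_single plus_fword_def)
    then show ?case
      using Cons hom[of "letter a" "Poly_Mapping.single (Word l) 1"] gens[of a] gen[of a] mult
      by (auto simp: letter_def free_single)
  qed
  have single: "P (\<pi> (Poly_Mapping.single w c))" if "set (letters w) \<subseteq> A" for w c
  proof -
    have "Poly_Mapping.single w c = Poly_Mapping.single 0 c * Poly_Mapping.single w 1"
      by (simp add: mult_single)
    then show ?thesis
      using hom[of "Poly_Mapping.single 0 c" "Poly_Mapping.single w 1"] that word[of "letters w"]
        mult scal scalar by (simp add: free_single zero_fword_def)
  qed
  \<comment> \<open>The quotient map \<pi> is known to be additive on \<open>free_on A\<close> only,
    so the induction has to keep the partial sums inside it.\<close>
  have "P (\<pi> (sum f I)) \<and> sum f I \<in> free_on A"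
    if "finite I" "\<And>i. i \<in> I \<Longrightarrow> P (\<pi> (f i)) \<and> f i \<in> free_on A" for f and I :: "'g fword set"
    using that
  proof (induction I)
    case empty
    show ?case using scal[of 0] scalar[of 0] by (simp add: free_on_def)
  next
    case (insert i I)
    then have "f i + sum f I \<in> free_on A"
      using keys_add[of "f i" "sum f I"] by (fastforce simp: free_on_def)
    with insert show ?case using hom[of "f i" "sum f I"] add by simp
  qed
  note sums = this
  obtain f where f: "f \<in> free_on A" "b = \<pi> f" using surj by blast
  have "P (\<pi> (Poly_Mapping.single k (Poly_Mapping.lookup f k))) \<and>
      Poly_Mapping.single k (Poly_Mapping.lookup f k) \<in> free_on A" if "k \<in> Poly_Mapping.keys f" for k
  proof -
    have "set (letters k) \<subseteq> A" using f(1) that by (simp add: free_on_def)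
    then show ?thesis using single free_single by blast
  qed
  from sums[of "Poly_Mapping.keys f" "\<lambda>k. Poly_Mapping.single k (Poly_Mapping.lookup f k)", OF finite_keys this]
  have "P (\<pi> f)" by (simp only: poly_mapping_expand)
  then show ?thesis by (simp only: f)
qed

section \<open>Coset representatives\<close>

text \<open>On words, this is the well-definedness of the sign character of W.\<close>

lemma cox_eq_even_length: "cox_eq W S us vs \<Longrightarrow> even (length us) = even (length vs)"
  by (induction rule: cox_eq.induct)
    (simp_all add: length_concat sum_list_replicate map_replicate_const)

context coxeter_system
begin

lemma word_prod_closed: "ws \<in> lists S \<Longrightarrow> word_prod W ws \<in> carrier W"
  by (induction ws) (use S_subset in \<open>auto simp: word_prod_def\<close>)

lemma word_prod_append:
  "us \<in> lists S \<Longrightarrow> vs \<in> lists S \<Longrightarrow> word_prod W (us @ vs) = word_prod W us \<otimes> word_prod W vs"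
proof (induction us)
  case Nil
  then show ?case using word_prod_closed[of vs] by (simp add: word_prod_def)
next
  case (Cons a us)
  then show ?case using word_prod_closed[of vs] word_prod_closed[of us] S_subset
    by (auto simp: word_prod_def m_assoc)
qed

text \<open>Generators are their own inverses, so words without inverse letters already exhaust the
  generated subgroup.\<close>

lemma ex_word:
  assumes "w \<in> carrier W" shows "\<exists>ws\<in>lists S. word_prod W ws = w"
proof -
  have "w \<in> generate W S" using assms S_generates by simp
  then show ?thesis
  proof induction
    case one
    show ?case by (rule bexI[of _ "[]"]) (simp_all add: word_prod_def)
  next
    case (incl h)
    then show ?case using S_subset by (intro bexI[of _ "[h]"]) (auto simp: word_prod_def)
  next
    case (inv h)
    then have "inv h = h" using S_involutive[of h] S_subset by (auto intro: inv_equality)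
    then show ?case using inv S_subset by (intro bexI[of _ "[h]"]) (auto simp: word_prod_def)
  next
    case (eng h1 h2)
    then obtain us vs where "us \<in> lists S" "word_prod W us = h1" "vs \<in> lists S" "word_prod W vs = h2"
      by blast
    then show ?case by (intro bexI[of _ "us @ vs"]) (simp_all add: word_prod_append)
  qed
qed

lemma ex_reduced_word:
  assumes "w \<in> carrier W" shows "\<exists>ws. reduced_word W S w ws"
proof -
  obtain ws where "ws \<in> lists S" "word_prod W ws = w" using ex_word[OF assms] by blast
  then have "\<exists>n. \<exists>ws\<in>lists S. length ws = n \<and> word_prod W ws = w" by blast
  from LeastI_ex[OF this] show ?thesis unfolding reduced_word_def cox_len_def by blast
qed

text \<open>The relators of a Coxeter group have even length, so the parity of a word depends only on
  the group element it represents.\<close>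

lemma cox_len_mult_neq:
  assumes "s \<in> S" "w \<in> carrier W"
  shows "cox_len W S (s \<otimes> w) \<noteq> cox_len W S w"
proof
  assume eq: "cox_len W S (s \<otimes> w) = cox_len W S w"
  have sw: "s \<otimes> w \<in> carrier W" using assms S_subset by auto
  obtain us vs where us: "reduced_word W S w us" and vs: "reduced_word W S (s \<otimes> w) vs"
    using ex_reduced_word assms(2) sw by blast
  \<comment> \<open>Both words represent sw. If w and sw had the same length n, these words would
    have lengths n + 1 and n, of different parity.\<close>
  then have "cox_eq W S (s # us) vs"
    using assms by (intro S_presents) (auto simp: reduced_word_def word_prod_def)
  from cox_eq_even_length[OF this] show False
    using us vs eq by (simp add: reduced_word_def)
qed

text \<open>Since l(sz) differs from l(z), it is either larger or smaller. The cases are those in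
  which \<open>is_HY\<close> prescribes the action of a generator on z|m, so that action is known
  for every z in D_J.\<close>

lemma coset_reps_cases:
  assumes "s \<in> S" "z \<in> coset_reps W S J"
  obtains "z \<in> reps_plus W S J s" | "z \<in> reps_zero W S J s" | "z \<in> reps_minus W S J s"
  using assms cox_len_mult_neq[of s z] nat_neq_iff
  by (auto simp: reps_plus_def reps_zero_def reps_minus_def coset_reps_def)

end

section \<open>Tensor products\<close>

text \<open>The three clauses say that the additive extension of g kills the generators of
  \<open>tensor_relations\<close>, hence that g factors through the tensor product over
  \<open>HJ\<close>.\<close>

definition balanced_map :: "'h set \<Rightarrow> ('k, 'h::ring_1, 'v::ab_group_add) kmod \<Rightarrow>
    ('h \<Rightarrow> 'v \<Rightarrow> 't::ab_group_add) \<Rightarrow> bool" where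
  "balanced_map HJ V g \<longleftrightarrow>
     (\<forall>h h'. \<forall>u\<in>carrier V. g (h + h') u = g h u + g h' u) \<and>
     (\<forall>h. \<forall>u\<in>carrier V. \<forall>w\<in>carrier V. g h (u + w) = g h u + g h w) \<and>
     (\<forall>h. \<forall>a\<in>HJ. \<forall>u\<in>carrier V. g (h * a) u = g h (act V a u))"

text \<open>This gives access to the induction rule and the universal property of free abelian
  groups.\<close>

lemma pure_pair_eq_frag_of: "pure_pair h u = frag_of (h, u)"
  by (simp add: pure_pair_def)

locale tensor_product =
  fixes HJ :: "'h::ring_1 set" and V :: "('k, 'h, 'v::ab_group_add) kmod"
    and tens :: "'h \<Rightarrow> 'v \<Rightarrow> 't::ab_group_add"
  assumes tensor: "is_tensor HJ V tens"
    and carrier_closed: "add_closed (carrier V)"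
    and act_closed: "u \<in> carrier V \<Longrightarrow> act V a u \<in> carrier V"
    and smul_closed: "u \<in> carrier V \<Longrightarrow> smul V c u \<in> carrier V"
    and smul_add: "additive_on (carrier V) (smul V c)"
    and smul_act: "u \<in> carrier V \<Longrightarrow> smul V c (act V a u) = act V a (smul V c u)"
begin

lemma presentation:
  obtains \<pi> where "additive \<pi>" "\<And>h u. u \<in> carrier V \<Longrightarrow> \<pi> (frag_of (h, u)) = tens h u"
    "\<And>t. \<exists>f. Poly_Mapping.keys f \<subseteq> UNIV \<times> carrier V \<and> \<pi> f = t"
    "\<And>f. Poly_Mapping.keys f \<subseteq> UNIV \<times> carrier V \<Longrightarrow> \<pi> f = 0 \<longleftrightarrow> f \<in> tensor_relations HJ V"
proof -
  obtain \<pi> where \<pi>: "additive \<pi>" "\<forall>h. \<forall>u\<in>carrier V. \<pi> (pure_pair h u) = tens h u"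
    "\<pi> ` {f. Poly_Mapping.keys f \<subseteq> UNIV \<times> carrier V} = UNIV"
    "\<forall>f. Poly_Mapping.keys f \<subseteq> UNIV \<times> carrier V \<longrightarrow> (\<pi> f = 0 \<longleftrightarrow> f \<in> tensor_relations HJ V)"
    using tensor unfolding is_tensor_def by blast
  from \<pi>(3) have "\<exists>f. Poly_Mapping.keys f \<subseteq> UNIV \<times> carrier V \<and> \<pi> f = t" for t
    by (metis (mono_tags, lifting) UNIV_I image_iff mem_Collect_eq)
  with \<pi> show ?thesis by (intro that[of \<pi>]) (auto simp: pure_pair_eq_frag_of)
qed

lemma balanced_tens: "balanced_map HJ V tens"
proof -
  obtain \<pi> where \<pi>: "additive \<pi>" "\<And>h u. u \<in> carrier V \<Longrightarrow> \<pi> (frag_of (h, u)) = tens h u"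
    and ker: "\<And>f. Poly_Mapping.keys f \<subseteq> UNIV \<times> carrier V \<Longrightarrow> \<pi> f = 0 \<longleftrightarrow> f \<in> tensor_relations HJ V"
    using presentation by metis
  have rel: "\<pi> f = \<pi> g + \<pi> h" if "f - g - h \<in> tensor_relations HJ V"
    "Poly_Mapping.keys f \<subseteq> UNIV \<times> carrier V" "Poly_Mapping.keys g \<subseteq> UNIV \<times> carrier V"
    "Poly_Mapping.keys h \<subseteq> UNIV \<times> carrier V" for f g h
  proof -
    have "\<pi> (f - g - h) = 0"
      using that ker[of "f - g - h"] keys_diff[of "f - g" h] keys_diff[of f g] by blast
    then show ?thesis by (simp add: additive.diff[OF \<pi>(1)] additive.add[OF \<pi>(1)] algebra_simps)
  qed
  have sum: "u + w \<in> carrier V" if "u \<in> carrier V" "w \<in> carrier V" for u w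
    using that carrier_closed by (simp add: add_closed_def)
  show ?thesis unfolding balanced_map_def
  proof (intro conjI allI ballI)
    fix h h' u assume u: "u \<in> carrier V"
    show "tens (h + h') u = tens h u + tens h' u"
      using rel[OF tensor_relations.add_left[OF u, unfolded pure_pair_eq_frag_of]] u
      by (simp add: keys_frag_of \<pi>)
  next
    fix h u w assume u: "u \<in> carrier V" "w \<in> carrier V"
    show "tens h (u + w) = tens h u + tens h w"
      using rel[OF tensor_relations.add_right[OF u, unfolded pure_pair_eq_frag_of]] u
      by (simp add: keys_frag_of \<pi> sum)
  next
    fix h a u assume a: "a \<in> HJ" "u \<in> carrier V"
    show "tens (h * a) u = tens h (act V a u)"
      using rel[of "frag_of (h * a, u)" "frag_of (h, act V a u)" 0]
        tensor_relations.balanced[OF a, unfolded pure_pair_eq_frag_of] a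
      by (simp add: keys_frag_of \<pi> act_closed additive.zero[OF \<pi>(1)])
  qed
qed

text \<open>Pure tensors generate the tensor product as a group, being the images of the generators
  of the free group that maps onto it.\<close>

lemma additive_eqI:
  assumes "additive G" "additive G'" "\<And>h u. u \<in> carrier V \<Longrightarrow> G (tens h u) = G' (tens h u)"
  shows "G t = G' t"
proof -
  obtain \<pi> f where \<pi>: "additive \<pi>" "\<And>h u. u \<in> carrier V \<Longrightarrow> \<pi> (frag_of (h, u)) = tens h u"
    and f: "Poly_Mapping.keys f \<subseteq> UNIV \<times> carrier V" "\<pi> f = t"
    using presentation by metis
  have "G (\<pi> f) = G' (\<pi> f)"
    using f(1)
  proof (induction f rule: frag_induction)
    case zero
    show ?case by (simp add: additive.zero[OF \<pi>(1)] additive.zero[OF assms(1)] additive.zero[OF assms(2)])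
  next
    case (one x)
    then show ?case using assms(3) \<pi>(2) by (cases x) simp
  next
    case (diff a b)
    then show ?case by (simp add: additive.diff[OF \<pi>(1)] additive.diff[OF assms(1)] additive.diff[OF assms(2)])
  qed
  with f show ?thesis by simp
qed

text \<open>This is the existence half of the universal property. The map g extends to a
  homomorphism \<Phi> on the free group on pairs, which vanishes on \<open>tensor_relations\<close>.
  The lift is \<Phi> after a section \<sigma> of the quotient map; it is additive because two
  representatives of one tensor differ by a relation.\<close>

lemma ex_lift:
  fixes g :: "'h \<Rightarrow> 'v \<Rightarrow> 'u::ab_group_add"
  assumes "balanced_map HJ V g"
  shows "\<exists>G. additive G \<and> (\<forall>h. \<forall>u\<in>carrier V. G (tens h u) = g h u)"
proof -
  let ?A = "\<lparr>carrier = UNIV, monoid.mult = (+), one = 0::'u\<rparr>"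
  have "comm_group ?A"
  proof (rule comm_groupI)
    fix x :: 'u
    show "\<exists>y\<in>carrier ?A. y \<otimes>\<^bsub>?A\<^esub> x = \<one>\<^bsub>?A\<^esub>" by (rule bexI[of _ "- x"]) simp_all
  qed (simp_all add: add.assoc add.commute)
  \<comment> \<open>\<Phi> is defined on all pairs, also those whose second entry lies outside the
    carrier. Its values there do no harm, because \<sigma> below chooses representatives supported
    on \<open>UNIV \<times> carrier V\<close>.\<close>
  from comm_group.free_Abelian_group_universal[OF this, of "\<lambda>x. g (fst x) (snd x)" UNIV]
  obtain \<Phi> where "\<Phi> \<in> hom (free_Abelian_group (UNIV :: ('h \<times> 'v) set)) ?A"
    and one: "\<And>x. \<Phi> (frag_of x) = g (fst x) (snd x)"
    by auto
  then have \<Phi>: "additive \<Phi>"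
    by (intro additive.intro) (auto simp: hom_def free_Abelian_group_def)
  have vanish: "\<Phi> f = 0" if "f \<in> tensor_relations HJ V" for f
    using that
  proof induction
    case zero
    then show ?case by (simp add: additive.zero[OF \<Phi>])
  qed (use assms in \<open>simp_all add: additive.diff[OF \<Phi>] pure_pair_eq_frag_of one balanced_map_def\<close>)
  obtain \<pi> where \<pi>: "additive \<pi>" "\<And>h u. u \<in> carrier V \<Longrightarrow> \<pi> (frag_of (h, u)) = tens h u"
    and surj: "\<And>t. \<exists>f. Poly_Mapping.keys f \<subseteq> UNIV \<times> carrier V \<and> \<pi> f = t"
    and ker: "\<And>f. Poly_Mapping.keys f \<subseteq> UNIV \<times> carrier V \<Longrightarrow> \<pi> f = 0 \<longleftrightarrow> f \<in> tensor_relations HJ V"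
    using presentation by metis
  from surj obtain \<sigma> where \<sigma>: "\<And>t. Poly_Mapping.keys (\<sigma> t) \<subseteq> UNIV \<times> carrier V" "\<And>t. \<pi> (\<sigma> t) = t"
    by metis
  have eq: "\<Phi> (\<sigma> (\<pi> f)) = \<Phi> f" if "Poly_Mapping.keys f \<subseteq> UNIV \<times> carrier V" for f
  proof -
    have "\<pi> (\<sigma> (\<pi> f) - f) = 0" by (simp add: additive.diff[OF \<pi>(1)] \<sigma>)
    moreover have "Poly_Mapping.keys (\<sigma> (\<pi> f) - f) \<subseteq> UNIV \<times> carrier V"
      using keys_diff[of "\<sigma> (\<pi> f)" f] \<sigma>(1)[of "\<pi> f"] that by blast
    ultimately have "\<Phi> (\<sigma> (\<pi> f) - f) = 0" using ker vanish by blast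
    then show ?thesis by (simp add: additive.diff[OF \<Phi>])
  qed
  show ?thesis
  proof (intro exI[of _ "\<Phi> \<circ> \<sigma>"] conjI allI ballI)
    show "additive (\<Phi> \<circ> \<sigma>)"
    proof
      fix t t'
      have "Poly_Mapping.keys (\<sigma> t + \<sigma> t') \<subseteq> UNIV \<times> carrier V"
        using keys_add[of "\<sigma> t" "\<sigma> t'"] \<sigma>(1) by blast
      from eq[OF this] show "(\<Phi> \<circ> \<sigma>) (t + t') = (\<Phi> \<circ> \<sigma>) t + (\<Phi> \<circ> \<sigma>) t'"
        by (simp add: additive.add[OF \<pi>(1)] \<sigma> additive.add[OF \<Phi>])
    qed
    show "(\<Phi> \<circ> \<sigma>) (tens h u) = g h u" if "u \<in> carrier V" for h u
      using eq[of "frag_of (h, u)"] that by (simp add: keys_frag_of \<pi> one)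
  qed
qed

text \<open>The definite description is justified by \<open>ex_lift\<close> for existence and
  \<open>additive_eqI\<close> for uniqueness.\<close>

lemma tensor_lift:
  fixes g :: "'h \<Rightarrow> 'v \<Rightarrow> 'u::ab_group_add"
  assumes "balanced_map HJ V g"
  shows "additive (tensor_lift V tens g)" "u \<in> carrier V \<Longrightarrow> tensor_lift V tens g (tens h u) = g h u"
proof -
  have "\<exists>!G. additive G \<and> (\<forall>h. \<forall>u\<in>carrier V. G (tens h u) = g h u)"
    using ex_lift[OF assms] by (rule ex_ex1I) (rule ext, rule additive_eqI, auto)
  from theI'[OF this, folded tensor_lift_def]
  show "additive (tensor_lift V tens g)" "u \<in> carrier V \<Longrightarrow> tensor_lift V tens g (tens h u) = g h u"
    by blast+
qed

lemma tens_zero: "tens h 0 = 0"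
  using balanced_tens carrier_closed unfolding balanced_map_def add_closed_def
  by (metis add_cancel_right_left)

text \<open>Scalars can be moved past the action of \<open>HJ\<close>, so they act on the second
  factor of the tensor product.\<close>

lemma balanced_smul: "balanced_map HJ V (\<lambda>h u. tens h (smul V c u))"
  using balanced_tens smul_add[of c] by (simp add: balanced_map_def additive_on_def smul_closed smul_act)

lemma balanced_mult: "balanced_map HJ V (\<lambda>h u. tens (h' * h) u)"
  using balanced_tens by (simp add: balanced_map_def distrib_left mult.assoc[symmetric])

end

section \<open>Functoriality of the tensor product and of induction\<close>

lemma balanced_hom:
  assumes "tensor_product HJ V tens" "tensor_product HJ V' tens'" "kmod_hom V V' \<theta>"
  shows "balanced_map HJ V (\<lambda>h u. tens' h (\<theta> u))"
  using assms(3) tensor_product.balanced_tens[OF assms(2)]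
  by (simp add: balanced_map_def kmod_hom_def)

lemma hecke_Ind_map:
  assumes "tensor_product HJ V tens" "tensor_product HJ V' tens'" "kmod_hom V V' (laurent_map \<phi>)"
  shows "additive (hecke_Ind_map V tens tens' \<phi>)"
    "u \<in> carrier V \<Longrightarrow> hecke_Ind_map V tens tens' \<phi> (tens h u) = tens' h (laurent_map \<phi> u)"
  using tensor_product.tensor_lift[OF assms(1) balanced_hom[OF assms]]
  by (simp_all add: hecke_Ind_map_def)

lemma additive_comp: "additive f \<Longrightarrow> additive g \<Longrightarrow> additive (\<lambda>x. f (g x))"
  by (simp add: additive_def)

text \<open>Each linearity claim compares two additive maps on the tensor product, so pure tensors
  suffice. Scalars act on the second factor, where \<open>laurent_map \<phi>\<close> is linear; H
  acts on the first factor, which the induced map leaves alone.\<close>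

lemma kmod_hom_hecke_Ind_map:
  assumes V: "tensor_product HJ V tens" "tensor_product HJ V' tens'"
    and hom: "kmod_hom V V' (laurent_map \<phi>)"
  shows "kmod_hom (hecke_Ind V tens) (hecke_Ind V' tens') (hecke_Ind_map V tens tens' \<phi>)"
proof -
  interpret V: tensor_product HJ V tens by fact
  interpret V': tensor_product HJ V' tens' by fact
  note I = hecke_Ind_map[OF assms]
  note smul = V.tensor_lift[OF V.balanced_smul] V'.tensor_lift[OF V'.balanced_smul]
  note mult = V.tensor_lift[OF V.balanced_mult] V'.tensor_lift[OF V'.balanced_mult]
  have hom': "laurent_map \<phi> u \<in> carrier V'"
    "laurent_map \<phi> (smul V c u) = smul V' c (laurent_map \<phi> u)" if "u \<in> carrier V" for u c
    using hom that by (simp_all add: kmod_hom_def)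
  show ?thesis
    unfolding kmod_hom_def
  proof (intro conjI allI ballI)
    show "hecke_Ind_map V tens tens' \<phi> (smul (hecke_Ind V tens) c t) =
        smul (hecke_Ind V' tens') c (hecke_Ind_map V tens tens' \<phi> t)" for c t
      unfolding hecke_Ind_def kmod.simps
      by (rule V.additive_eqI[OF additive_comp[OF I(1) smul(1)] additive_comp[OF smul(3) I(1)]])
        (simp add: smul I hom' V.smul_closed)
    show "hecke_Ind_map V tens tens' \<phi> (act (hecke_Ind V tens) a t) =
        act (hecke_Ind V' tens') a (hecke_Ind_map V tens tens' \<phi> t)" for a t
      unfolding hecke_Ind_def kmod.simps
      by (rule V.additive_eqI[OF additive_comp[OF I(1) mult(1)] additive_comp[OF mult(3) I(1)]])
        (simp add: mult I hom')
  qed (simp_all add: hecke_Ind_def additive.add[OF I(1)])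
qed

section \<open>Restriction to the Hecke algebra\<close>

lemma is_kmodD:
  assumes "is_kmod M"
  shows "add_closed (carrier M)" "additive_on (carrier M) (smul M c)" "additive_on (carrier M) (act M a)"
    "u \<in> carrier M \<Longrightarrow> smul M c u \<in> carrier M" "u \<in> carrier M \<Longrightarrow> act M a u \<in> carrier M"
    "u \<in> carrier M \<Longrightarrow> act M a (smul M c u) = smul M c (act M a u)"
    "u \<in> carrier M \<Longrightarrow> act M (a + b) u = act M a u + act M b u"
    "u \<in> carrier M \<Longrightarrow> act M (a * b) u = act M a (act M b u)"
    "u \<in> carrier M \<Longrightarrow> act M 1 u = u"
    "smul M c 0 = 0" "act M a 0 = 0"
proof -
  show *: "add_closed (carrier M)" "additive_on (carrier M) (smul M c)" "additive_on (carrier M) (act M a)"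
    using assms by (simp_all add: is_kmod_def add_closed_def additive_on_def)
  show "smul M c 0 = 0" "act M a 0 = 0"
    using additive_on_zero * by blast+
qed (use assms in \<open>simp_all add: is_kmod_def\<close>)

lemma kmod_homD:
  assumes "kmod_hom M N f"
  shows "additive_on (carrier M) f" "u \<in> carrier M \<Longrightarrow> f u \<in> carrier N"
    "u \<in> carrier M \<Longrightarrow> f (smul M c u) = smul N c (f u)"
    "u \<in> carrier M \<Longrightarrow> f (act M a u) = act N a (f u)"
  using assms by (simp_all add: kmod_hom_def additive_on_def)

text \<open>Every Laurent polynomial over the acting algebra preserves the carrier and commutes with
  scalars, because each of its coefficients does. The conditions therefore hold for each
  \<open>j a\<close> on its own.\<close>

lemma tensor_product_hecke_Res:
  assumes "is_kmod M" "is_tensor HJ (hecke_Res j M) tens"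
  shows "tensor_product HJ (hecke_Res j M) tens"
proof
  note M = is_kmodD[OF assms(1)]
  show "add_closed (carrier (hecke_Res j M))"
    using add_closed_range[OF M(1)] by (simp add: hecke_Res_def)
  show "act (hecke_Res j M) a u \<in> carrier (hecke_Res j M)" if "u \<in> carrier (hecke_Res j M)" for a u
    using range_laurent_pair[OF M(1,5)] that by (simp add: hecke_Res_def)
  show "smul (hecke_Res j M) c u \<in> carrier (hecke_Res j M)" if "u \<in> carrier (hecke_Res j M)" for c u
    using range_laurent_pair[OF M(1,4)] that by (simp add: hecke_Res_def)
  show "additive_on (carrier (hecke_Res j M)) (smul (hecke_Res j M) c)" for c
    using additive_on_laurent_pair[OF M(1,2)] by (simp add: hecke_Res_def)
  show "smul (hecke_Res j M) c (act (hecke_Res j M) a u) = act (hecke_Res j M) a (smul (hecke_Res j M) c u)"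
    if "u \<in> carrier (hecke_Res j M)" for a c u
    unfolding hecke_Res_def kmod.simps
    by (rule laurent_pair_commute[where C = "carrier M"]) (use M that in \<open>simp_all add: hecke_Res_def\<close>)
qed (fact assms(2))

text \<open>This serves twice: for \<phi> between the modules that are induced, and for
  \<open>HY_map \<phi>\<close> between the restrictions of the Howlett-Yin modules.\<close>

lemma kmod_hom_laurent_map:
  assumes "is_kmod M" "is_kmod N" "kmod_hom M N \<phi>"
  shows "kmod_hom (hecke_Res j M) (hecke_Res j N) (laurent_map \<phi>)"
proof -
  note M = is_kmodD[OF assms(1)] and N = is_kmodD[OF assms(2)] and \<phi> = kmod_homD[OF assms(3)]
  show ?thesis unfolding kmod_hom_def
  proof (intro conjI allI ballI)
    fix u assume "u \<in> carrier (hecke_Res j M)"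
    then have u: "Poly_Mapping.range u \<subseteq> carrier M" by (simp add: hecke_Res_def)
    show "laurent_map \<phi> u \<in> carrier (hecke_Res j N)"
      using range_map_subset[OF M(1) N(1) \<phi>(1,2) u] by (simp add: hecke_Res_def laurent_map_def)
    show "laurent_map \<phi> (u + w) = laurent_map \<phi> u + laurent_map \<phi> w"
      if "w \<in> carrier (hecke_Res j M)" for w
      using map_add_on[OF M(1) \<phi>(1) u] that by (simp add: hecke_Res_def laurent_map_def)
    show "laurent_map \<phi> (smul (hecke_Res j M) c u) = smul (hecke_Res j N) c (laurent_map \<phi> u)" for c
      using laurent_map_laurent_pair[where b = "smul M" and b' = "smul N", OF M(1) \<phi>(1) M(4) \<phi>(3) N(10) u]
      by (simp add: hecke_Res_def)
    show "laurent_map \<phi> (act (hecke_Res j M) a u) = act (hecke_Res j N) a (laurent_map \<phi> u)" for a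
      using laurent_map_laurent_pair[where b = "act M" and b' = "act N", OF M(1) \<phi>(1) M(5) \<phi>(4) N(11) u]
      by (simp add: hecke_Res_def)
  qed
qed

section \<open>Howlett-Yin induction\<close>

lemma HY_map_single: "\<phi> 0 = 0 \<Longrightarrow> HY_map \<phi> (Poly_Mapping.single z m) = Poly_Mapping.single z (\<phi> m)"
  by (simp add: HY_map_def map_single)

lemma is_HY_act_Egen:
  assumes "is_HY W S J L g gJ \<mu> M N" "s \<in> S" "m \<in> carrier M"
  shows "z \<in> reps_plus W S J s \<Longrightarrow> act N (g (Egen s)) (Poly_Mapping.single z m) = 0"
    "z \<in> reps_zero W S J s \<Longrightarrow> act N (g (Egen s)) (Poly_Mapping.single z m) =
          Poly_Mapping.single z (act M (gJ (Egen (conj_by W s z))) m)"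
    "z \<in> reps_minus W S J s \<Longrightarrow> act N (g (Egen s)) (Poly_Mapping.single z m) =
          Poly_Mapping.single z m"
  using assms by (simp_all add: is_HY_def)

lemma is_HY_act_Xgen:
  assumes "is_HY W S J L g gJ \<mu> M N" "s \<in> S" "m \<in> carrier M" "- L s < \<gamma>" "\<gamma> < L s"
  shows "z \<in> reps_plus W S J s \<Longrightarrow> act N (g (Xgen s \<gamma>)) (Poly_Mapping.single z m) =
          (\<Sum>x\<in>{x \<in> coset_reps W S J. bruhat_less W S x z}.
             Poly_Mapping.single x (act M (Poly_Mapping.lookup (\<mu> s x z) \<gamma>) m)) +
          (if \<gamma> = 0 then Poly_Mapping.single (s \<otimes>\<^bsub>W\<^esub> z) m else 0)"
    "z \<in> reps_zero W S J s \<Longrightarrow> act N (g (Xgen s \<gamma>)) (Poly_Mapping.single z m) =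
          (\<Sum>x\<in>{x \<in> coset_reps W S J. bruhat_less W S x z}.
             Poly_Mapping.single x (act M (Poly_Mapping.lookup (\<mu> s x z) \<gamma>) m)) +
          Poly_Mapping.single z (act M (gJ (Xgen (conj_by W s z) \<gamma>)) m)"
    "z \<in> reps_minus W S J s \<Longrightarrow> act N (g (Xgen s \<gamma>)) (Poly_Mapping.single z m) = 0"
  using assms by (simp_all add: is_HY_def)

lemma is_HYD:
  assumes "is_HY W S J L g gJ \<mu> M N"
  shows "is_kmod N"
    "f \<in> carrier N \<longleftrightarrow> Poly_Mapping.keys f \<subseteq> coset_reps W S J \<and> Poly_Mapping.range f \<subseteq> carrier M"
    "f \<in> carrier N \<Longrightarrow> smul N c f = Poly_Mapping.map (smul M c) f"
  using assms by (simp_all add: is_HY_def)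

text \<open>The elements of \<Omega> whose action commutes with \<open>HY_map \<phi>\<close> are
  closed under sums and products and contain the integers. It remains to check the generators, and
  by additivity only on z|m, where their coefficients act through \<open>\<Omega>\<^sub>J\<close>
  and so commute with \<phi>.\<close>

lemma kmod_hom_HY_map:
  fixes N :: "('k::{comm_ring, comm_monoid_mult}, 'o::ring_1, 'w \<Rightarrow>\<^sub>0 'm::ab_group_add) kmod"
  assumes cox: "coxeter_system W S" and pres: "is_wgraph_algebra W S L g"
    and M: "is_kmod M" "is_kmod M'" and hom: "kmod_hom M M' \<phi>"
    and HY: "is_HY W S J L g gJ \<mu> M N" "is_HY W S J L g gJ \<mu> M' N'"
  shows "kmod_hom N N' (HY_map \<phi>)"
proof -
  note M1 = is_kmodD[OF M(1)] and M2 = is_kmodD[OF M(2)] and \<phi> = kmod_homD[OF hom]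
  note N1 = is_kmodD[OF is_HYD(1)[OF HY(1)]] and N2 = is_kmodD[OF is_HYD(1)[OF HY(2)]]
  note carrier = is_HYD(2)[OF HY(1)] is_HYD(2)[OF HY(2)]
  note act = is_HY_act_Egen[OF HY(1)] is_HY_act_Xgen[OF HY(1)]
    is_HY_act_Egen[OF HY(2)] is_HY_act_Xgen[OF HY(2)]
  have 0: "\<phi> 0 = 0" "0 \<in> carrier M" using additive_on_zero[OF M1(1) \<phi>(1)] M1(1) by (simp_all add: add_closed_def)
  \<comment> \<open>This group is larger than \<open>carrier N\<close>: supports may be any finite
    subset of the type, so the image of z|m under a generator can be split into its terms without
    tracking the indices that occur.\<close>
  let ?D = "{f :: 'w \<Rightarrow>\<^sub>0 'm. Poly_Mapping.range f \<subseteq> carrier M}"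
  note D = add_closed_range[OF M1(1)]
  have add_D: "additive_on ?D (HY_map \<phi>)"
    using additive_on_map[OF M1(1) \<phi>(1)] by (simp add: HY_map_def)
  have add_HY: "additive_on (carrier N) (HY_map \<phi>)"
    using add_D by (auto simp: additive_on_def carrier)
  have HY_closed: "HY_map \<phi> f \<in> carrier N'" if "f \<in> carrier N" for f
    using that range_map_subset[OF M1(1) M2(1) \<phi>(1,2), of f] keys_map_subset[of \<phi> f]
    by (auto simp: carrier HY_map_def)
  have HY_zero: "HY_map \<phi> (0 :: 'w \<Rightarrow>\<^sub>0 'm) = 0" using additive_on_zero[OF D add_D] .
  have single_D: "Poly_Mapping.single x m \<in> ?D" if "m \<in> carrier M" for x m
    using that 0 by (simp add: range_subset_iff_lookup lookup_single when_def)
  have HY_sum: "HY_map \<phi> ((\<Sum>x\<in>X. Poly_Mapping.single x (k x)) + Poly_Mapping.single y m) =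
      (\<Sum>x\<in>X. Poly_Mapping.single x (\<phi> (k x))) + Poly_Mapping.single y (\<phi> m)"
    if "\<And>x. k x \<in> carrier M" "m \<in> carrier M" for X :: "'w set" and k y m
  proof -
    have "(\<Sum>x\<in>X. Poly_Mapping.single x (k x)) \<in> ?D"
      by (intro add_closed_sum D single_D that)
    with add_D single_D[OF that(2)] have "HY_map \<phi> ((\<Sum>x\<in>X. Poly_Mapping.single x (k x)) + Poly_Mapping.single y m) =
        HY_map \<phi> (\<Sum>x\<in>X. Poly_Mapping.single x (k x)) + HY_map \<phi> (Poly_Mapping.single y m)"
      unfolding additive_on_def by blast
    then show ?thesis
      using additive_on_sum[OF D add_D, of X "\<lambda>x. Poly_Mapping.single x (k x)"] single_D[OF that(1)]
      by (simp add: HY_map_single 0)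
  qed
  let ?comm = "\<lambda>a. \<forall>f\<in>carrier N. HY_map \<phi> (act N a f) = act N' a (HY_map \<phi> f)"
  \<comment> \<open>Both sides are additive in f, and f is the sum of its components.\<close>
  have singles: "?comm a"
    if single: "\<And>z m. z \<in> coset_reps W S J \<Longrightarrow> m \<in> carrier M \<Longrightarrow>
      HY_map \<phi> (act N a (Poly_Mapping.single z m)) = act N' a (Poly_Mapping.single z (\<phi> m))" for a
  proof
    fix f assume f: "f \<in> carrier N"
    let ?s = "\<lambda>z. Poly_Mapping.single z (Poly_Mapping.lookup f z)"
    have z: "z \<in> coset_reps W S J" "Poly_Mapping.lookup f z \<in> carrier M" if "z \<in> Poly_Mapping.keys f" for z
      using f that by (auto simp: carrier lookup_in_if_range_subset 0)
    have s: "?s z \<in> carrier N" if "z \<in> Poly_Mapping.keys f" for z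
      using z[OF that] by (simp add: carrier)
    have s': "Poly_Mapping.single z (\<phi> (Poly_Mapping.lookup f z)) \<in> carrier N'"
      if "z \<in> Poly_Mapping.keys f" for z
      using HY_closed[OF s[OF that]] by (simp add: HY_map_single 0)
    have "HY_map \<phi> (act N a (sum ?s (Poly_Mapping.keys f))) = act N' a (HY_map \<phi> (sum ?s (Poly_Mapping.keys f)))"
      using s s' N1(5) z
      by (simp add: additive_on_sum[OF N1(1,3)] additive_on_sum[OF N1(1) add_HY]
          additive_on_sum[OF N2(1,3)] single HY_map_single 0)
    then show "HY_map \<phi> (act N a f) = act N' a (HY_map \<phi> f)" by (simp add: poly_mapping_expand)
  qed
  have comm: "?comm a" for a
    using pres[unfolded is_wgraph_algebra_def]
  proof (induction a rule: presented_algebra_induct)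
    \<comment> \<open>The scalars are integers. They act by repeated addition and by negation, which
      every additive map respects.\<close>
    case (scalar c)
    have act_zero: "act N 0 f = 0" if "f \<in> carrier N" for f
      using N1(7)[OF that, of 0 0] by simp
    have act_zero': "act N' 0 f = 0" if "f \<in> carrier N'" for f
      using N2(7)[OF that, of 0 0] by simp
    have act_minus: "act N (- a) f = - act N a f" if "f \<in> carrier N" for a f
      using N1(7)[OF that, of a "- a"] act_zero[OF that] by (simp add: minus_unique)
    have act_minus': "act N' (- a) f = - act N' a f" if "f \<in> carrier N'" for a f
      using N2(7)[OF that, of a "- a"] act_zero'[OF that] by (simp add: minus_unique)
    have nat: "?comm (of_nat n)" for n
      by (induction n) (use N1(5,7,9) N2(7,9) HY_closed add_HY
        in \<open>simp_all add: act_zero act_zero' HY_zero additive_on_def\<close>)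
    show ?case
      by (cases c) (use nat in \<open>simp_all add: act_minus act_minus' HY_closed
          additive_on_minus[OF N1(1) add_HY] N1(5) del: of_nat_Suc\<close>)
  next
    case (gen a)
    then consider s where "s \<in> S" "a = Egen s" | s \<gamma> where "s \<in> S" "- L s < \<gamma>" "\<gamma> < L s" "a = Xgen s \<gamma>"
      by (auto simp: wgraph_alphabet_def)
    then show ?case
    proof cases
      case 1
      show ?thesis
      proof (rule singles)
        fix z m assume z: "z \<in> coset_reps W S J" "m \<in> carrier M"
        show "HY_map \<phi> (act N (g a) (Poly_Mapping.single z m)) = act N' (g a) (Poly_Mapping.single z (\<phi> m))"
          by (rule coxeter_system.coset_reps_cases[OF cox 1(1) z(1)])
            (simp_all add: 1 act z \<phi> HY_zero HY_map_single 0)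
      qed
    next
      case 2
      show ?thesis
      proof (rule singles)
        fix z m assume z: "z \<in> coset_reps W S J" "m \<in> carrier M"
        show "HY_map \<phi> (act N (g a) (Poly_Mapping.single z m)) = act N' (g a) (Poly_Mapping.single z (\<phi> m))"
        proof (rule coxeter_system.coset_reps_cases[OF cox 2(1) z(1)])
          assume "z \<in> reps_plus W S J s"
          \<comment> \<open>The term sz|m is present for \<gamma> = 0 only. Replacing m by 0 for the
            other exponents gives both cases the shape of \<open>HY_sum\<close>.\<close>
          then show ?thesis
            using HY_sum[of "\<lambda>x. act M (Poly_Mapping.lookup (\<mu> s x z) \<gamma>) m"
                "if \<gamma> = 0 then m else 0"] z 0 2(2,3)
            by (cases "\<gamma> = 0") (simp_all add: 2 act \<phi> M1(5))
        qed (simp_all add: 2 act z \<phi> HY_zero HY_sum M1(5))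
      qed
    qed
  next
    case (add x y)
    then show ?case using add_HY N1(5,7) N2(7) HY_closed by (simp add: additive_on_def)
  next
    case (mult x y)
    then show ?case using N1(5,8) N2(8) HY_closed by simp
  qed
  show ?thesis unfolding kmod_hom_def
  proof (intro conjI allI ballI)
    show "HY_map \<phi> (smul N c f) = smul N' c (HY_map \<phi> f)" if "f \<in> carrier N" for c f
    proof -
      have "Poly_Mapping.lookup f k \<in> carrier M" for k
        using that 0 by (simp add: carrier lookup_in_if_range_subset)
      then show ?thesis
        by (intro poly_mapping_eqI)
          (simp add: is_HYD(3)[OF HY(1) that] is_HYD(3)[OF HY(2) HY_closed[OF that]],
            simp add: HY_map_def lookup_map 0 M1(10) M2(10) \<phi>)
    qed
  qed (use HY_closed add_HY comm in \<open>auto simp: additive_on_def\<close>)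
qed

section \<open>Naturality of the canonicalisation\<close>

lemma canonicalisation_widen:
  assumes "tensor_product HJ (hecke_Res j M) tens"
    "finite A" "Poly_Mapping.keys F \<subseteq> A"
    "\<And>\<gamma>. finite (B \<gamma>)" "\<And>\<gamma>. Poly_Mapping.keys (Poly_Mapping.lookup F \<gamma>) \<subseteq> B \<gamma>"
  shows "canonicalisation W S J T p M tens F =
    (\<Sum>\<gamma>\<in>A. \<Sum>z\<in>B \<gamma>. \<Sum>y\<in>{y \<in> coset_reps W S J. bruhat_le W S y z}.
        tens (hecke_T W S T y)
          (laurent_pair (act M) (p y z)
             (vmono \<gamma> (Poly_Mapping.lookup (Poly_Mapping.lookup F \<gamma>) z))))"
proof -
  \<comment> \<open>A vanishing component of F yields a vanishing tensor, which is why indices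
    outside the supports may be added.\<close>
  have 0: "tens h (laurent_pair (act M) q 0) = 0" for h q
    using tensor_product.tens_zero[OF assms(1)] by (simp add: laurent_pair_def)
  have inner: "(\<Sum>z\<in>Poly_Mapping.keys (Poly_Mapping.lookup F \<gamma>). \<Sum>y\<in>Y z. tens (h y)
          (laurent_pair (act M) (p y z) (vmono \<gamma> (Poly_Mapping.lookup (Poly_Mapping.lookup F \<gamma>) z)))) =
      (\<Sum>z\<in>B \<gamma>. \<Sum>y\<in>Y z. tens (h y)
          (laurent_pair (act M) (p y z) (vmono \<gamma> (Poly_Mapping.lookup (Poly_Mapping.lookup F \<gamma>) z))))"
    for \<gamma> h Y
    by (rule sum.mono_neutral_left) (use assms in \<open>auto simp: in_keys_iff 0\<close>)
  show ?thesis
    unfolding canonicalisation_def inner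
    by (rule sum.mono_neutral_left) (use assms in \<open>auto simp: in_keys_iff 0\<close>)
qed

text \<open>The induced map is additive, so it can be evaluated term by term on the sum over
  \<gamma>, z and y. On each term \<phi> passes through \<open>p y z\<close>, whose coefficients act
  by elements of \<open>\<Omega>\<^sub>J\<close>.\<close>

lemma canonicalisation_natural:
  assumes M: "is_kmod M" "is_kmod M'" and hom: "kmod_hom M M' \<phi>"
    and V: "tensor_product HJ (hecke_Res j M) tens" "tensor_product HJ (hecke_Res j M') tens'"
    and F: "\<And>\<gamma>. Poly_Mapping.range (Poly_Mapping.lookup F \<gamma>) \<subseteq> carrier M"
  shows "canonicalisation W S J T p M' tens' (laurent_map (HY_map \<phi>) F) =
    hecke_Ind_map (hecke_Res j M) tens tens' \<phi> (canonicalisation W S J T p M tens F)"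
proof -
  note M1 = is_kmodD[OF M(1)] and M2 = is_kmodD[OF M(2)] and \<phi> = kmod_homD[OF hom]
  note I = hecke_Ind_map[OF V kmod_hom_laurent_map[OF M hom]]
  have 0: "\<phi> 0 = 0" "0 \<in> carrier M" using additive_on_zero[OF M1(1) \<phi>(1)] M1(1) by (simp_all add: add_closed_def)
  have HY0: "HY_map \<phi> 0 = 0" by (rule poly_mapping_eqI) (simp add: HY_map_def lookup_map 0)
  let ?m = "\<lambda>\<gamma> z. Poly_Mapping.lookup (Poly_Mapping.lookup F \<gamma>) z"
  have m: "?m \<gamma> z \<in> carrier M" for \<gamma> z using F 0 by (simp add: lookup_in_if_range_subset)
  have single: "Poly_Mapping.range (vmono \<gamma> (?m \<gamma> z)) \<subseteq> carrier M" for \<gamma> z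
    using m 0 by (simp add: range_subset_iff_lookup lookup_single when_def)
  have on_term: "hecke_Ind_map (hecke_Res j M) tens tens' \<phi>
      (tens h (laurent_pair (act M) q (vmono \<gamma> (?m \<gamma> z)))) =
    tens' h (laurent_pair (act M') q (vmono \<gamma> (\<phi> (?m \<gamma> z))))" for h q \<gamma> z
    using I(2)[of "laurent_pair (act M) q (vmono \<gamma> (?m \<gamma> z))" h]
      range_laurent_pair[where b = "act M" and q = q, OF M1(1,5) single[of \<gamma> z]]
      laurent_map_laurent_pair[where b = "act M" and b' = "act M'", OF M1(1) \<phi>(1) M1(5) \<phi>(4) M2(11) single[of \<gamma> z],
        where q = q]
    by (simp add: hecke_Res_def laurent_map_def map_single 0)
  \<comment> \<open>The supports of the image of F may be smaller than those of F; the sum is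
    written over the latter to match the other side.\<close>
  have "canonicalisation W S J T p M' tens' (laurent_map (HY_map \<phi>) F) =
    (\<Sum>\<gamma>\<in>Poly_Mapping.keys F. \<Sum>z\<in>Poly_Mapping.keys (Poly_Mapping.lookup F \<gamma>).
      \<Sum>y\<in>{y \<in> coset_reps W S J. bruhat_le W S y z}.
        tens' (hecke_T W S T y) (laurent_pair (act M') (p y z) (vmono \<gamma> (\<phi> (?m \<gamma> z)))))"
    by (subst canonicalisation_widen[OF V(2), of "Poly_Mapping.keys F" _
          "\<lambda>\<gamma>. Poly_Mapping.keys (Poly_Mapping.lookup F \<gamma>)"])
      (simp_all add: laurent_map_def lookup_map HY0 keys_map_subset, simp_all add: HY_map_def lookup_map 0 keys_map_subset)
  also have "\<dots> = hecke_Ind_map (hecke_Res j M) tens tens' \<phi> (canonicalisation W S J T p M tens F)"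
    by (simp add: canonicalisation_def additive.sum[OF I(1)] on_term)
  finally show ?thesis .
qed

theorem theorem5p1:
  fixes W :: "('w, 'b) monoid_scheme" and S J :: "'w set" and L :: "'w \<Rightarrow> int"
    and \<omega> :: "'w wgen \<Rightarrow> 'o::ring_1" and \<omega>J :: "'w wgen \<Rightarrow> 'oj::ring_1"
    and \<eta> :: "int laurent \<Rightarrow> 'h::ring_1" and T :: "'w \<Rightarrow> 'h"
    and j :: "'h \<Rightarrow> 'o laurent" and jJ :: "'h \<Rightarrow> 'oj laurent"
    and \<iota> :: "'h \<Rightarrow> 'h" and R :: "'w \<Rightarrow> 'w \<Rightarrow> int laurent"
    and p :: "'w \<Rightarrow> 'w \<Rightarrow> 'oj laurent" and \<mu> :: "'w \<Rightarrow> 'w \<Rightarrow> 'w \<Rightarrow> 'oj laurent"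
    and M1 :: "('k::{comm_ring, comm_monoid_mult}, 'oj, 'm1::ab_group_add) kmod"
    and M2 :: "('k, 'oj, 'm2::ab_group_add) kmod"
    and M3 :: "('k, 'oj, 'm3::ab_group_add) kmod"
    and N1 :: "('k, 'o, 'w \<Rightarrow>\<^sub>0 'm1) kmod"
    and N2 :: "('k, 'o, 'w \<Rightarrow>\<^sub>0 'm2) kmod"
    and N3 :: "('k, 'o, 'w \<Rightarrow>\<^sub>0 'm3) kmod"
    and tens1 :: "'h \<Rightarrow> 'm1 laurent \<Rightarrow> 't1::ab_group_add"
    and tens2 :: "'h \<Rightarrow> 'm2 laurent \<Rightarrow> 't2::ab_group_add"
    and \<phi> :: "'m1 \<Rightarrow> 'm2" and \<psi> :: "'m2 \<Rightarrow> 'm3"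
  defines "HJ \<equiv> hecke_parabolic W S J \<eta> T"
    and "V1 \<equiv> hecke_Res jJ M1"
    and "V2 \<equiv> hecke_Res jJ M2"
    and "c1 \<equiv> canonicalisation W S J T p M1 tens1"
    and "c2 \<equiv> canonicalisation W S J T p M2 tens2"
  assumes "coxeter_system W S" and "pos_weight_function W S L" and "J \<subseteq> S"
    and "is_wgraph_algebra W S L \<omega>"
    and "is_wgraph_algebra (parabolic W J) J L \<omega>J"
    and "is_hecke_algebra W S L \<eta> T"
    and "is_hecke_inclusion UNIV S L \<eta> T \<omega> j"
    and "is_hecke_inclusion HJ J L \<eta> T \<omega>J jJ"
    and "is_hecke_bar S \<eta> T \<iota>" and "is_R_family W S \<eta> T \<iota> R"
    and "is_p_family W S J (\<lambda>x z. jJ (rel_r W S J \<eta> T R x z)) p"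
    and "is_mu_family W S J L \<omega>J p \<mu>"
    and "is_kmod M1" and "is_kmod M2" and "is_kmod M3"
    and "is_HY W S J L \<omega> \<omega>J \<mu> M1 N1"
    and "is_HY W S J L \<omega> \<omega>J \<mu> M2 N2"
    and "is_HY W S J L \<omega> \<omega>J \<mu> M3 N3"
    and "is_tensor HJ V1 tens1" and "is_tensor HJ V2 tens2"
    and "kmod_hom M1 M2 \<phi>" and "kmod_hom M2 M3 \<psi>"
  shows "
    \<comment> \<open>(a)\<close>
    kmod_hom N1 N2 (HY_map \<phi>) \<and>
    (\<forall>f\<in>carrier N1. HY_map (\<lambda>m. m) f = f) \<and>
    (\<forall>f\<in>carrier N1. HY_map (\<psi> \<circ> \<phi>) f = HY_map \<psi> (HY_map \<phi> f)) \<and>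
    \<comment> \<open>(b); that the components of \<open>c\<close> are isomorphisms is the known theorem on the canonicalisation\<close>
    (\<forall>F\<in>carrier (hecke_Res j N1).
       c2 (laurent_map (HY_map \<phi>) F) = hecke_Ind_map V1 tens1 tens2 \<phi> (c1 F)) \<and>
    kmod_hom (hecke_Res j N1) (hecke_Res j N2) (laurent_map (HY_map \<phi>)) \<and>
    kmod_hom (hecke_Ind V1 tens1) (hecke_Ind V2 tens2) (hecke_Ind_map V1 tens1 tens2 \<phi>) \<and>
    (kmod_iso (hecke_Res j N1) (hecke_Ind V1 tens1) c1 \<and>
     kmod_iso (hecke_Res j N2) (hecke_Ind V2 tens2) c2 \<longrightarrow>
     natural_iso_square (hecke_Res j N1) (hecke_Res j N2) (hecke_Ind V1 tens1) (hecke_Ind V2 tens2)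
       (laurent_map (HY_map \<phi>)) (hecke_Ind_map V1 tens1 tens2 \<phi>) c1 c2)"
proof -
  note A = assms(6-)
  note M = A(13-15) and HY = A(16-18) and hom = A(21,22)
  have "coxeter_system W S" "is_wgraph_algebra W S L \<omega>" by fact+
  note hom_HY = kmod_hom_HY_map[OF this M(1,2) hom(1) HY(1,2)]
  have V: "tensor_product HJ V1 tens1" "tensor_product HJ V2 tens2"
    using tensor_product_hecke_Res[OF M(1)] tensor_product_hecke_Res[OF M(2)] A(19,20)
    by (simp_all add: assms(2,3))
  \<comment> \<open>\<open>Poly_Mapping.map\<close> applies a function to nonzero coefficients only,
    so compatibility with composition rests on both maps fixing 0.\<close>
  have \<phi>0: "\<phi> 0 = 0" and \<psi>0: "\<psi> 0 = 0"
    using additive_on_zero[OF is_kmodD(1)[OF M(1)] kmod_homD(1)[OF hom(1)]]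
      additive_on_zero[OF is_kmodD(1)[OF M(2)] kmod_homD(1)[OF hom(2)]] by auto
  have id: "HY_map (\<lambda>m. m) f = f" for f :: "'w \<Rightarrow>\<^sub>0 'm1"
    by (rule poly_mapping_eqI) (simp add: HY_map_def lookup_map)
  have comp: "HY_map (\<psi> \<circ> \<phi>) f = HY_map \<psi> (HY_map \<phi> f)" for f
    by (rule poly_mapping_eqI) (simp add: HY_map_def lookup_map \<phi>0 \<psi>0)
  have hom_Res: "kmod_hom (hecke_Res j N1) (hecke_Res j N2) (laurent_map (HY_map \<phi>))"
    using kmod_hom_laurent_map[OF is_HYD(1)[OF HY(1)] is_HYD(1)[OF HY(2)] hom_HY] .
  have hom_Ind: "kmod_hom (hecke_Ind V1 tens1) (hecke_Ind V2 tens2) (hecke_Ind_map V1 tens1 tens2 \<phi>)"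
    by (rule kmod_hom_hecke_Ind_map[OF V]) (simp add: assms(2,3) kmod_hom_laurent_map[OF M(1,2) hom(1)])
  have natural: "c2 (laurent_map (HY_map \<phi>) F) = hecke_Ind_map V1 tens1 tens2 \<phi> (c1 F)"
    if F: "F \<in> carrier (hecke_Res j N1)" for F
  proof -
    have "0 \<in> carrier N1" using is_kmodD(1)[OF is_HYD(1)[OF HY(1)]] by (simp add: add_closed_def)
    with F have "Poly_Mapping.lookup F \<gamma> \<in> carrier N1" for \<gamma>
      by (simp add: hecke_Res_def lookup_in_if_range_subset)
    then have "Poly_Mapping.range (Poly_Mapping.lookup F \<gamma>) \<subseteq> carrier M1" for \<gamma>
      using is_HYD(2)[OF HY(1)] by blast
    from canonicalisation_natural[OF M(1,2) hom(1) V[unfolded assms(2,3)] this]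
    show ?thesis by (simp add: assms(2-5))
  qed
  show ?thesis
    unfolding natural_iso_square_def
    by (intro conjI ballI impI) (simp_all only: hom_HY id comp natural hom_Res hom_Ind)
qed

end
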